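(* Let $F$ be a graph with $m$ edges and no isolated vertices. Then, for every integer $k\ge 3$, \[ r_k(F)\le k^{\,3\cdot 2^{-1/3}\,k\,m^{2/3}+k(2m)^{1/3}}\cdot 8m . \]
   Context: Graphs are finite and simple. For a graph $F$ and a positive integer $k$, the multicolor Ramsey number $r_k(F)$ is the least integer $n$ such that in every coloring of the edges of the complete graph $K_n$ by $k$ colors there is a monochromatic copy of $F$, i.e. a (not necessarily induced) subgraph of $K_n$ isomorphic to $F$ all of whose edges have the same color. *)

theory Defs
  imports Complex_Main "HOL-Library.Ramsey"
begin

text \<open>A graph is given by a vertex set \<open>V\<close> and an edge set \<open>E\<close> of two-element subsets of \<open>V\<close>;
  \<open>nsets V 2\<close> is the set of all of these, so the complete graph \<open>K\<^sub>n\<close> is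
  \<open>{..<n}\<close> with edge set \<open>nsets {..<n} 2\<close>.\<close>

definition simple_graph :: "'a set \<Rightarrow> 'a set set \<Rightarrow> bool" where
  "simple_graph V E \<longleftrightarrow> finite V \<and> E \<subseteq> nsets V 2"

definition subgraph_of :: "'a set \<Rightarrow> 'a set set \<Rightarrow> 'a set \<Rightarrow> 'a set set \<Rightarrow> bool" where
  "subgraph_of W D V E \<longleftrightarrow> simple_graph W D \<and> W \<subseteq> V \<and> D \<subseteq> E"

definition graph_isomorphic :: "'a set \<Rightarrow> 'a set set \<Rightarrow> 'b set \<Rightarrow> 'b set set \<Rightarrow> bool" where
  "graph_isomorphic V E W D \<longleftrightarrow>
     (\<exists>\<phi>. bij_betw \<phi> V W \<and> (\<forall>u\<in>V. \<forall>v\<in>V. {u, v} \<in> E \<longleftrightarrow> {\<phi> u, \<phi> v} \<in> D))"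

definition isolated_vertex :: "'a set \<Rightarrow> 'a set set \<Rightarrow> 'a \<Rightarrow> bool" where
  "isolated_vertex V E v \<longleftrightarrow> v \<in> V \<and> (\<forall>e\<in>E. v \<notin> e)"

definition ramsey_arrow :: "nat \<Rightarrow> nat \<Rightarrow> 'a set \<Rightarrow> 'a set set \<Rightarrow> bool" where
  "ramsey_arrow n k V E \<longleftrightarrow>
     (\<forall>c \<in> nsets {..<n} 2 \<rightarrow> {..<k}. \<exists>W D. \<exists>i<k.
        subgraph_of W D {..<n} (nsets {..<n} 2) \<and> graph_isomorphic V E W D \<and> (\<forall>e\<in>D. c e = i))"

definition multicolor_ramsey :: "nat \<Rightarrow> 'a set \<Rightarrow> 'a set set \<Rightarrow> nat" where
  "multicolor_ramsey k V E = (LEAST n. ramsey_arrow n k V E)"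

text \<open>By Ramsey's theorem the minimum is attained.\<close>

lemma ramsey_arrow_multicolor_ramsey:
  fixes V :: "'a set"
  assumes "simple_graph V E"
  shows "ramsey_arrow (multicolor_ramsey k V E) k V E"
proof -
  obtain N :: nat where N: "partn_lst {..<N} (replicate k (card V)) 2"
    using ramsey_full by blast
  have "ramsey_arrow N k V E"
    unfolding ramsey_arrow_def
  proof
    fix c :: "nat set \<Rightarrow> nat"
    assume "c \<in> nsets {..<N} 2 \<rightarrow> {..<k}"
    then obtain i H where i: "i < k" and H: "H \<in> nsets {..<N} (card V)"
      and mono: "c ` nsets H 2 \<subseteq> {i}"
      by (rule partn_lstE[OF N]) auto
    have fH: "finite H" "card H = card V" "H \<subseteq> {..<N}"
      using H by (auto simp: nsets_def)
    have fV: "finite V" and E: "E \<subseteq> nsets V 2"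
      using assms unfolding simple_graph_def by blast+
    obtain \<phi> where \<phi>: "bij_betw \<phi> V H"
      using finite_same_card_bij[OF fV fH(1)] fH(2) by auto
    define D where "D = (\<lambda>e. \<phi> ` e) ` E"
    have inj: "inj_on \<phi> V" and im: "\<phi> ` V = H"
      using \<phi> by (auto simp: bij_betw_def)
    have D: "D \<subseteq> nsets H 2"
    proof
      fix d assume "d \<in> D"
      then obtain e where e: "e \<in> E" "d = \<phi> ` e" by (auto simp: D_def)
      then have "e \<subseteq> V" "finite e" "card e = 2" using E by (auto simp: nsets_def)
      moreover have "card (\<phi> ` e) = card e"
        using \<open>e \<subseteq> V\<close> inj card_image inj_on_subset by blast
      ultimately show "d \<in> nsets H 2" using e im by (auto simp: nsets_def)
    qed
    have "{u, v} \<in> E \<longleftrightarrow> {\<phi> u, \<phi> v} \<in> D" if "u \<in> V" "v \<in> V" for u v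
    proof
      assume "{u, v} \<in> E"
      then show "{\<phi> u, \<phi> v} \<in> D" unfolding D_def using imageI[of "{u, v}" E "\<lambda>e. \<phi> ` e"] by simp
    next
      assume "{\<phi> u, \<phi> v} \<in> D"
      then obtain e where e: "e \<in> E" "\<phi> ` {u, v} = \<phi> ` e" unfolding D_def by (elim imageE) simp
      then have "e \<subseteq> V" using E by (auto simp: nsets_def)
      then have "{u, v} = e"
        using e(2) inj_on_image_eq_iff[OF inj, of "{u, v}" e] that by simp
      then show "{u, v} \<in> E" using e by simp
    qed
    then have "graph_isomorphic V E H D"
      using \<phi> unfolding graph_isomorphic_def by blast
    moreover have "subgraph_of H D {..<N} (nsets {..<N} 2)"
      using D fH nsets_mono[OF fH(3), of 2]
      unfolding subgraph_of_def simple_graph_def by simp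
    moreover have "\<forall>e\<in>D. c e = i" using D mono by blast
    ultimately show "\<exists>W D. \<exists>i<k. subgraph_of W D {..<N} (nsets {..<N} 2) \<and>
        graph_isomorphic V E W D \<and> (\<forall>e\<in>D. c e = i)"
      using i by blast
  qed
  then show ?thesis
    unfolding multicolor_ramsey_def by (rule LeastI)
qed

end

theory Submission
  imports Defs
begin

text \<open>
  Split \<open>F\<close> into the few vertices of degree at least \<open>D\<close>, where \<open>D\<close> is about \<open>(2m)\<^sup>1\<^sup>/\<^sup>3\<close>, and a graph of
  maximum degree at most \<open>d = D - 1\<close>. Shrink the vertex set \<open>U\<close> of the coloured complete graph
  repeatedly, each time using the densest colour \<open>i\<close> in \<open>U\<close>. The first uses of a colour pick a vertex
  and pass to its neighbourhood, at the cost of a factor \<open>k\<close>; these vertices will host the high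
  degree vertices. The last \<open>d\<close> uses, with \<open>s = d, \<dots>, 1\<close>, pass to the common neighbourhood of
  \<open>s + 1\<close> random vertices, at the cost of a factor \<open>k\<^sup>s\<^sup>+\<^sup>1\<close>; afterwards few \<open>s\<close>-tuples of the new set have a
  small common neighbourhood in the old one. Once some colour has no use left, the low degree part
  is embedded from the smallest set upwards. Its vertices are arranged in independent levels so that
  a vertex of level \<open>s\<close> has at most \<open>s\<close> neighbours in lower levels, and it is placed into a common
  neighbourhood of their images.

  The random choice bounds the absolute number of bad tuples by \<open>n\<^sup>s\<^sup>-\<^sup>1\<close>, where \<open>n = 2m\<close>,
  and this bound survives all later restrictions to subsets, whatever their colour. Since
  every vertex is placed with at least \<open>n\<close> choices, a given bad set is hit with probability below
  \<open>1 / n\<close>, and there are at most \<open>n\<close> of these sets.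
\<close>

subsection \<open>Dependent random choice\<close>

text \<open>A vertex counts as its own neighbour in every colour. So the densest colour has density at
  least \<open>1 / k\<close> without an error term, and the embedding avoids loops by choosing unused vertices.\<close>

definition common_nbhd :: "('b set \<Rightarrow> nat) \<Rightarrow> nat \<Rightarrow> 'b set \<Rightarrow> 'b set \<Rightarrow> 'b set" where
  "common_nbhd c i U S = {v \<in> U. \<forall>w\<in>S. v = w \<or> c {v, w} = i}"

text \<open>Entries may repeat. Extensional functions make the counts of tuples over a set exact
  powers of its size.\<close>

definition bad_tuples :: "('b set \<Rightarrow> nat) \<Rightarrow> nat \<Rightarrow> nat \<Rightarrow> 'b set \<Rightarrow> 'b set \<Rightarrow> nat \<Rightarrow> (nat \<Rightarrow> 'b) set" where
  "bad_tuples c i M X Y s = {g \<in> {..<s} \<rightarrow>\<^sub>E Y. card (common_nbhd c i X (g ` {..<s})) < M}"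

lemma common_nbhd_subset: "common_nbhd c i U S \<subseteq> U"
  by (auto simp: common_nbhd_def)

lemma common_nbhd_antimono: "S \<subseteq> T \<Longrightarrow> common_nbhd c i U T \<subseteq> common_nbhd c i U S"
  by (auto simp: common_nbhd_def)

lemma finite_bad_tuples: "finite Y \<Longrightarrow> finite (bad_tuples c i M X Y s)"
  unfolding bad_tuples_def by (rule finite_subset[of _ "{..<s} \<rightarrow>\<^sub>E Y"]) (auto intro: finite_PiE)

lemma bad_tuples_mono:
  assumes "X \<subseteq> X'" "finite X'" "Y' \<subseteq> Y"
  shows "bad_tuples c i M X' Y' s \<subseteq> bad_tuples c i M X Y s"
proof
  fix g assume g: "g \<in> bad_tuples c i M X' Y' s"
  have "card (common_nbhd c i X (g ` {..<s})) \<le> card (common_nbhd c i X' (g ` {..<s}))"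
    using assms by (intro card_mono) (auto simp: common_nbhd_def)
  with g show "g \<in> bad_tuples c i M X Y s"
    using assms(3) PiE_mono[of "{..<s}" "\<lambda>_. Y'" "\<lambda>_. Y"] by (auto simp: bad_tuples_def)
qed

text \<open>Being adjacent or equal is symmetric: \<open>S\<close> lies in the common neighbourhood
  of \<open>t\<close> iff each entry of \<open>t\<close> lies in that of \<open>S\<close>.\<close>

lemma tuples_common_nbhd:
  assumes "S \<subseteq> U"
  shows "{t \<in> I \<rightarrow>\<^sub>E U. S \<subseteq> common_nbhd c i U (t ` I)} = I \<rightarrow>\<^sub>E common_nbhd c i U S"
  using assms by (fastforce simp: common_nbhd_def PiE_def Pi_def insert_commute)

lemma sum_card_swap:
  assumes "finite A" "finite B"
  shows "(\<Sum>a\<in>A. card {b\<in>B. R a b}) = (\<Sum>b\<in>B. card {a\<in>A. R a b})"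
proof -
  have "(\<Sum>a\<in>A. card {b\<in>B. R a b}) = (\<Sum>a\<in>A. \<Sum>b\<in>B. if R a b then 1 else 0)"
    using assms by (intro sum.cong) (auto simp: sum.If_cases Int_def)
  also have "\<dots> = (\<Sum>b\<in>B. \<Sum>a\<in>A. if R a b then 1 else 0)" by (rule sum.swap)
  also have "\<dots> = (\<Sum>b\<in>B. card {a\<in>A. R a b})"
    using assms by (intro sum.cong) (auto simp: sum.If_cases Int_def)
  finally show ?thesis .
qed

text \<open>The power lies above its tangent at \<open>a\<close>. Writing \<open>a ^ t / a\<close>
  for \<open>a ^ (t - 1)\<close> also covers \<open>t = 0\<close>.\<close>

lemma power_tangent:
  fixes a x :: real
  assumes "0 < a" "0 \<le> x"
  shows "x ^ t \<ge> a ^ t + real t * (x - a) * (a ^ t / a)"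
proof -
  have "(1 + (x / a - 1)) ^ t \<ge> 1 + real t * (x / a - 1)"
    using assms by (intro Bernoulli_inequality) simp
  then have "a ^ t * (x / a) ^ t \<ge> a ^ t * (1 + real t * (x / a - 1))"
    using assms by (intro mult_left_mono) auto
  moreover have "a ^ t * (x / a) ^ t = x ^ t"
    using assms by (simp add: power_divide)
  moreover have "a ^ t * (1 + real t * (x / a - 1)) = a ^ t + real t * (x - a) * (a ^ t / a)"
    using assms by (simp add: field_simps)
  ultimately show ?thesis by simp
qed

text \<open>Power mean inequality: the tangents at \<open>a\<close> are summed, and the linear terms
  total at least 0 because \<open>f\<close> has mean at least \<open>a\<close>.\<close>

lemma sum_power_ge:
  fixes a :: real and f :: "'b \<Rightarrow> real"
  assumes "finite U" "0 < a" "\<And>v. v \<in> U \<Longrightarrow> 0 \<le> f v" "real (card U) * a \<le> sum f U"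
  shows "real (card U) * a ^ t \<le> (\<Sum>v\<in>U. f v ^ t)"
proof -
  have "(\<Sum>v\<in>U. a ^ t + real t * (f v - a) * (a ^ t / a)) \<le> (\<Sum>v\<in>U. f v ^ t)"
    using assms by (intro sum_mono power_tangent) auto
  also have "(\<Sum>v\<in>U. a ^ t + real t * (f v - a) * (a ^ t / a))
      = real (card U) * a ^ t + real t * (sum f U - real (card U) * a) * (a ^ t / a)"
    by (simp only: sum.distrib sum_subtractf sum_constant flip: sum_distrib_left sum_distrib_right)
  finally show ?thesis using assms
    by (smt (verit) divide_nonneg_nonneg mult_nonneg_nonneg of_nat_0_le_iff zero_le_power)
qed

text \<open>If no choice of \<open>s + 1\<close> vertices worked, every choice would have either a small common
  neighbourhood or at least \<open>n\<^sup>s\<^sup>-\<^sup>1\<close> bad tuples in it; the sum of both conditions over all choices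
  contradicts the power mean inequality. The loss in size is only additive.\<close>

lemma dependent_random_choice:
  fixes c :: "'b set \<Rightarrow> nat"
  assumes U: "finite U" and k: "k > 0" and s: "s \<ge> 1" and n: "n \<ge> 1"
    and dense: "real (card U) * (real (card U) / real k) \<le> (\<Sum>v\<in>U. real (card (common_nbhd c i U {v})))"
    and loss: "real M ^ Suc s \<le> loss * real n ^ (s - 1)"
  shows "\<exists>U'\<subseteq>U. real (card U') \<ge> real (card U) / real k ^ Suc s - loss
            \<and> n * card (bad_tuples c i M U U' s) < n ^ s"
proof (cases "real (card U) / real k ^ Suc s - loss \<le> 0")
  case True
  \<comment> \<open>As \<open>s \<ge> 1\<close>, the empty set contains no \<open>s\<close>-tuple,
    so it serves when the required size is not positive.\<close>
  have "{..<s} \<rightarrow>\<^sub>E ({} :: 'b set) = {}"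
    using s by (auto simp: PiE_eq_empty_iff intro!: exI[of _ 0])
  then have "bad_tuples c i M U {} s = {}" by (simp add: bad_tuples_def)
  then show ?thesis using True n by (intro exI[of _ "{}"]) auto
next
  case False
  let ?u = "real (card U)" and ?t = "Suc s"
  let ?P = "{..<?t} \<rightarrow>\<^sub>E U"
  define C where "C t = common_nbhd c i U (t ` {..<?t})" for t
  define \<alpha> where "\<alpha> = ?u / real k ^ ?t - loss"
  have u: "?u > 0"
  proof -
    have "0 \<le> loss * real n ^ (s - 1)" using loss by (meson of_nat_0_le_iff order_trans zero_le_power)
    moreover have "real n ^ (s - 1) > 0" using n by simp
    ultimately have "0 \<le> loss" by (meson not_less zero_le_mult_iff)
    then show ?thesis using False by (cases "card U = 0") auto
  qed
  have fP: "finite ?P" using U by (intro finite_PiE) auto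
  have CU: "C t \<subseteq> U" for t by (simp add: C_def common_nbhd_subset)
  have "(\<Sum>t\<in>?P. card (C t)) = (\<Sum>t\<in>?P. card {v\<in>U. {v} \<subseteq> common_nbhd c i U (t ` {..<?t})})"
    using CU by (intro sum.cong arg_cong[where f=card]) (auto simp: C_def)
  also have "\<dots> = (\<Sum>v\<in>U. card {t\<in>?P. {v} \<subseteq> common_nbhd c i U (t ` {..<?t})})"
    by (rule sum_card_swap[OF fP U])
  also have "\<dots> = (\<Sum>v\<in>U. card ({..<?t} \<rightarrow>\<^sub>E common_nbhd c i U {v}))"
    by (intro sum.cong refl arg_cong[where f=card] tuples_common_nbhd) auto
  also have "\<dots> = (\<Sum>v\<in>U. card (common_nbhd c i U {v}) ^ ?t)"
    by (simp only: card_PiE finite_lessThan prod_constant card_lessThan)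
  finally have sz: "(\<Sum>t\<in>?P. real (card (C t))) = (\<Sum>v\<in>U. real (card (common_nbhd c i U {v})) ^ ?t)"
    by (simp only: of_nat_sum[symmetric] of_nat_power[symmetric])
  have szge: "?u * (?u / real k) ^ ?t \<le> (\<Sum>t\<in>?P. real (card (C t)))"
    unfolding sz using U u k dense by (intro sum_power_ge) auto
  let ?B = "bad_tuples c i M U U s"
  have fB: "finite ?B" by (rule finite_bad_tuples[OF U])
  have "(\<Sum>t\<in>?P. card (bad_tuples c i M U (C t) s)) = (\<Sum>t\<in>?P. card {g\<in>?B. g ` {..<s} \<subseteq> common_nbhd c i U (t ` {..<?t})})"
    using CU by (intro sum.cong refl arg_cong[where f=card]) (fastforce simp: C_def bad_tuples_def PiE_def Pi_def)
  also have "\<dots> = (\<Sum>g\<in>?B. card {t\<in>?P. g ` {..<s} \<subseteq> common_nbhd c i U (t ` {..<?t})})"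
    by (rule sum_card_swap[OF fP fB])
  also have "\<dots> = (\<Sum>g\<in>?B. card ({..<?t} \<rightarrow>\<^sub>E common_nbhd c i U (g ` {..<s})))"
    by (intro sum.cong refl arg_cong[where f=card] tuples_common_nbhd) (auto simp: bad_tuples_def)
  also have "\<dots> = (\<Sum>g\<in>?B. card (common_nbhd c i U (g ` {..<s})) ^ ?t)"
    by (simp only: card_PiE finite_lessThan prod_constant card_lessThan)
  \<comment> \<open>A bad tuple has fewer than \<open>M\<close> common neighbours, so it survives in
    \<open>C t\<close> for at most \<open>M ^ Suc s\<close> choices \<open>t\<close>.\<close>
  also have "\<dots> \<le> (\<Sum>g\<in>?B. M ^ ?t)"
    by (intro sum_mono power_mono) (auto simp: bad_tuples_def)
  also have "\<dots> = card ?B * M ^ ?t" by simp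
  also have "\<dots> \<le> card U ^ s * M ^ ?t"
  proof -
    have "card ?B \<le> card ({..<s} \<rightarrow>\<^sub>E U)"
      using U by (intro card_mono finite_PiE) (auto simp: bad_tuples_def)
    then show ?thesis by (simp add: card_PiE)
  qed
  finally have "real (\<Sum>t\<in>?P. card (bad_tuples c i M U (C t) s)) \<le> real (card U ^ s * M ^ ?t)"
    by (simp only: of_nat_le_iff)
  then have badle: "(\<Sum>t\<in>?P. real (card (bad_tuples c i M U (C t) s))) \<le> ?u ^ s * real M ^ ?t"
    by (simp only: of_nat_sum of_nat_mult of_nat_power)
  have cP: "real (card ?P) = ?u ^ ?t" by (simp add: card_PiE)
  show ?thesis
  proof (rule ccontr)
    assume no: "\<not> ?thesis"
    have npos: "real n ^ (s - 1) > 0" using n by simp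
    \<comment> \<open>A failing choice is either smaller than \<open>\<alpha>\<close> or contains at
      least \<open>n ^ (s - 1)\<close> bad tuples; then the second summand alone reaches
      \<open>card U\<close>.\<close>
    have pw: "real (card (C t)) < \<alpha> + ?u * (real (card (bad_tuples c i M U (C t) s)) / real n ^ (s - 1))"
      if "t \<in> ?P" for t
    proof (cases "real (card (C t)) < \<alpha>")
      case True
      then show ?thesis using npos u by (smt (verit) divide_nonneg_nonneg mult_nonneg_nonneg of_nat_0_le_iff)
    next
      case F: False
      then have "\<not> n * card (bad_tuples c i M U (C t) s) < n ^ s"
        using no CU[of t] by (auto simp: \<alpha>_def not_less)
      moreover have "n ^ s = n * n ^ (s - 1)" using s by (cases s) auto
      ultimately have "n ^ (s - 1) \<le> card (bad_tuples c i M U (C t) s)" using n by simp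
      then have "real n ^ (s - 1) \<le> real (card (bad_tuples c i M U (C t) s))"
        by (metis of_nat_le_iff of_nat_power)
      then have "1 \<le> real (card (bad_tuples c i M U (C t) s)) / real n ^ (s - 1)"
        using npos by simp
      then have "?u * 1 \<le> ?u * (real (card (bad_tuples c i M U (C t) s)) / real n ^ (s - 1))"
        by (intro mult_left_mono) auto
      moreover have "real (card (C t)) \<le> ?u" using CU U by (simp add: card_mono)
      moreover have "\<alpha> > 0" using False by (simp add: \<alpha>_def)
      ultimately show ?thesis by simp
    qed
    have "?P \<noteq> {}" using u by (auto simp: PiE_eq_empty_iff)
    then have "(\<Sum>t\<in>?P. real (card (C t)))
        < (\<Sum>t\<in>?P. \<alpha> + ?u * (real (card (bad_tuples c i M U (C t) s)) / real n ^ (s - 1)))"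
      using fP pw by (intro sum_strict_mono) auto
    also have "\<dots> = ?u ^ ?t * \<alpha> + ?u * ((\<Sum>t\<in>?P. real (card (bad_tuples c i M U (C t) s))) / real n ^ (s - 1))"
      by (simp only: sum.distrib sum_constant cP sum_distrib_left[symmetric] sum_divide_distrib[symmetric])
    also have "\<dots> \<le> ?u ^ ?t * \<alpha> + ?u * (?u ^ s * real M ^ ?t / real n ^ (s - 1))"
      using badle npos u by (intro add_left_mono mult_left_mono divide_right_mono) auto
    also have "?u * (?u ^ s * real M ^ ?t / real n ^ (s - 1)) = ?u ^ ?t * (real M ^ ?t / real n ^ (s - 1))"
      by simp
    also have "?u ^ ?t * \<alpha> + ?u ^ ?t * (real M ^ ?t / real n ^ (s - 1)) \<le> ?u ^ ?t * \<alpha> + ?u ^ ?t * loss"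
      using loss npos u by (intro add_left_mono mult_left_mono) (simp_all add: divide_le_eq del: power_Suc)
    also have "\<dots> = ?u * (?u / real k) ^ ?t"
      using u k by (simp add: \<alpha>_def field_simps)
    finally show False using szge by simp
  qed
qed

text \<open>Since \<open>v\<close> is its own neighbour in every colour, its neighbourhoods in the
  \<open>k\<close> colours cover \<open>U\<close>. The claim follows by averaging over the
  colours.\<close>

lemma dense_colour:
  fixes c :: "'b set \<Rightarrow> nat"
  assumes U: "finite U" and k: "k > 0" and c: "\<And>v w. v \<in> U \<Longrightarrow> w \<in> U \<Longrightarrow> v \<noteq> w \<Longrightarrow> c {v, w} < k"
  shows "\<exists>i<k. real (card U) * (real (card U) / real k) \<le> (\<Sum>v\<in>U. real (card (common_nbhd c i U {v})))"
proof (rule ccontr)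
  assume "\<not> ?thesis"
  then have lt: "\<And>i. i < k \<Longrightarrow> (\<Sum>v\<in>U. real (card (common_nbhd c i U {v}))) < real (card U) * (real (card U) / real k)"
    by (meson not_less)
  have v: "real (card U) \<le> (\<Sum>i<k. real (card (common_nbhd c i U {v})))" if "v \<in> U" for v
  proof -
    have "U \<subseteq> (\<Union>i<k. common_nbhd c i U {v})"
      using c that k by (auto simp: common_nbhd_def)
    moreover have "finite (\<Union>i<k. common_nbhd c i U {v})"
      using U by (auto simp: common_nbhd_def)
    ultimately have "card U \<le> card (\<Union>i<k. common_nbhd c i U {v})" by (rule card_mono[rotated])
    also have "\<dots> \<le> (\<Sum>i<k. card (common_nbhd c i U {v}))" by (rule card_UN_le) simp
    finally show ?thesis by (simp only: of_nat_sum[symmetric] of_nat_le_iff)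
  qed
  have "real (card U) * real (card U) = (\<Sum>v\<in>U. real (card U))" by simp
  also have "\<dots> \<le> (\<Sum>v\<in>U. \<Sum>i<k. real (card (common_nbhd c i U {v})))" by (intro sum_mono v)
  also have "\<dots> = (\<Sum>i<k. \<Sum>v\<in>U. real (card (common_nbhd c i U {v})))" by (rule sum.swap)
  also have "\<dots> < (\<Sum>i<k. real (card U) * (real (card U) / real k))"
    using k lt by (intro sum_strict_mono) auto
  also have "\<dots> = real (card U) * real (card U)" using k by simp
  finally show False by simp
qed

text \<open>Some vertex has at least the average degree; the 1 pays for deleting it from its own
  neighbourhood.\<close>

lemma dense_vertex:
  fixes c :: "'b set \<Rightarrow> nat"
  assumes U: "finite U" "U \<noteq> {}"
    and dense: "real (card U) * (real (card U) / real k) \<le> (\<Sum>v\<in>U. real (card (common_nbhd c i U {v})))"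
  shows "\<exists>v\<in>U. \<exists>U'\<subseteq>U - {v}. real (card U') \<ge> real (card U) / real k - 1 \<and> (\<forall>w\<in>U'. c {v, w} = i)"
proof -
  have "\<exists>v\<in>U. real (card U) / real k \<le> real (card (common_nbhd c i U {v}))"
  proof (rule ccontr)
    assume "\<not> ?thesis"
    then have "(\<Sum>v\<in>U. real (card (common_nbhd c i U {v}))) < (\<Sum>v\<in>U. real (card U) / real k)"
      using U by (intro sum_strict_mono) (auto simp: not_le)
    with dense show False by simp
  qed
  then obtain v where v: "v \<in> U" "real (card U) / real k \<le> real (card (common_nbhd c i U {v}))" by blast
  have "card (common_nbhd c i U {v}) \<le> Suc (card (common_nbhd c i U {v} - {v}))"
    by (metis card_Suc_Diff1 card_mono Diff_empty Diff_insert0 U(1) common_nbhd_subset finite_subset le_SucI order_refl)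
  with v have "real (card (common_nbhd c i U {v} - {v})) \<ge> real (card U) / real k - 1" by linarith
  moreover have "\<forall>w\<in>common_nbhd c i U {v} - {v}. c {v, w} = i"
    by (auto simp: common_nbhd_def insert_commute)
  moreover have "common_nbhd c i U {v} - {v} \<subseteq> U - {v}" by (auto simp: common_nbhd_def)
  ultimately show ?thesis using v(1) by blast
qed

subsection \<open>Embedding graphs of bounded degree\<close>

text \<open>Fixing \<open>card N\<close> distinct positions leaves \<open>s - card N\<close> free
  ones. When the image of a neighbourhood has too few common neighbours, all these completions are
  bad.\<close>

lemma card_completions:
  fixes Y :: "'b set" and e :: "'a \<Rightarrow> nat"
  assumes "finite N" "inj_on e N" "e ` N \<subseteq> {..<s}" "\<psi> ` N \<subseteq> Y" "finite Y"
  shows "card {g \<in> {..<s} \<rightarrow>\<^sub>E Y. \<forall>x\<in>N. g (e x) = \<psi> x} = card Y ^ (s - card N)"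
proof -
  let ?F = "\<lambda>j. if j \<in> e ` N then {\<psi> (the_inv_into N e j)} else Y"
  have inv: "the_inv_into N e (e x) = x" if "x \<in> N" for x
    using that assms(2) by (rule the_inv_into_f_f[rotated])
  have "{g \<in> {..<s} \<rightarrow>\<^sub>E Y. \<forall>x\<in>N. g (e x) = \<psi> x} = PiE {..<s} ?F"
  proof (intro equalityI subsetI)
    fix g assume g: "g \<in> {g \<in> {..<s} \<rightarrow>\<^sub>E Y. \<forall>x\<in>N. g (e x) = \<psi> x}"
    then show "g \<in> PiE {..<s} ?F" using inv by (auto simp: PiE_iff)
  next
    fix g assume g: "g \<in> PiE {..<s} ?F"
    have "g (e x) = \<psi> x" if "x \<in> N" for x
    proof -
      have "g (e x) \<in> ?F (e x)" using g assms(3) that by (intro PiE_mem[OF g]) auto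
      then show ?thesis using that inv by simp
    qed
    moreover have "g j \<in> Y" if "j < s" for j
    proof -
      have "g j \<in> ?F j" using that by (intro PiE_mem[OF g]) auto
      then show ?thesis using assms(4) inv by (auto split: if_splits)
    qed
    ultimately show "g \<in> {g \<in> {..<s} \<rightarrow>\<^sub>E Y. \<forall>x\<in>N. g (e x) = \<psi> x}"
      using g by (auto simp: PiE_iff)
  qed
  then have "card {g \<in> {..<s} \<rightarrow>\<^sub>E Y. \<forall>x\<in>N. g (e x) = \<psi> x} = (\<Prod>j<s. card (?F j))"
    by (simp add: card_PiE)
  also have "\<dots> = (\<Prod>j<s. if j \<in> e ` N then 1 else card Y)"
    by (intro prod.cong) auto
  also have "\<dots> = card Y ^ card ({..<s} - e ` N)"
    by (simp add: prod.If_cases Diff_eq Compl_eq)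
  also have "card ({..<s} - e ` N) = s - card N"
    using assms by (simp add: card_Diff_subset card_image)
  finally show ?thesis .
qed

text \<open>The vertex \<open>y\<close> waits for its neighbours \<open>N y\<close> to be embedded; only those in \<open>Z\<close> are placed
  so far, by \<open>\<psi>\<close>. The weight estimates the probability that a random continuation makes the
  image of \<open>N y\<close> a tuple of \<open>B y\<close>.\<close>

definition pending_weight ::
    "nat \<Rightarrow> ('a \<Rightarrow> nat) \<Rightarrow> ('a \<Rightarrow> 'a set) \<Rightarrow> ('a \<Rightarrow> 'a \<Rightarrow> nat) \<Rightarrow> ('a \<Rightarrow> (nat \<Rightarrow> 'b) set)
      \<Rightarrow> 'a set \<Rightarrow> ('a \<Rightarrow> 'b) \<Rightarrow> 'a \<Rightarrow> real" where
  "pending_weight n l N e B Z \<psi> y =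
     real (card {g \<in> B y. \<forall>x\<in>N y \<inter> Z. g (e y x) = \<psi> x}) * real n ^ card (N y \<inter> Z) / real n ^ l y"

lemma pending_weight_nonneg: "pending_weight n l N e B Z \<psi> y \<ge> 0"
  by (simp add: pending_weight_def)

text \<open>A supermartingale property: averaged over \<open>a\<close>, the weight does not grow.
  For \<open>x\<close> in \<open>N y\<close> the choices of \<open>a\<close> split the remaining
  tuples into disjoint classes, and the extra factor \<open>n\<close> is at most
  \<open>card A\<close>.\<close>

lemma pending_weight_extend:
  fixes A :: "'b set"
  assumes "finite A" "n \<le> card A" "finite (B y)" "finite (N y)" "x \<notin> Z"
  shows "(\<Sum>a\<in>A. pending_weight n l N e B (insert x Z) (\<psi>(x := a)) y)
    \<le> real (card A) * pending_weight n l N e B Z \<psi> y"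
proof (cases "x \<in> N y")
  case False
  then have "N y \<inter> insert x Z = N y \<inter> Z" by auto
  moreover have "(\<forall>z\<in>N y \<inter> Z. g (e y z) = (\<psi>(x := a)) z) = (\<forall>z\<in>N y \<inter> Z. g (e y z) = \<psi> z)" for g a
    using assms(5) by auto
  ultimately show ?thesis by (simp add: pending_weight_def)
next
  case True
  let ?C = "{g \<in> B y. \<forall>z\<in>N y \<inter> Z. g (e y z) = \<psi> z}"
  have ins: "N y \<inter> insert x Z = insert x (N y \<inter> Z)" using True by auto
  have cins: "card (insert x (N y \<inter> Z)) = Suc (card (N y \<inter> Z))" using assms by simp
  have eq: "{g \<in> B y. \<forall>z\<in>N y \<inter> insert x Z. g (e y z) = (\<psi>(x := a)) z} = {g \<in> ?C. g (e y x) = a}" for a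
    unfolding ins using assms(5) by auto
  have "(\<Sum>a\<in>A. card {g \<in> ?C. g (e y x) = a}) = card (\<Union>a\<in>A. {g \<in> ?C. g (e y x) = a})"
    using assms by (intro card_UN_disjoint[symmetric]) auto
  also have "\<dots> \<le> card ?C" using assms by (intro card_mono) auto
  finally have le: "(\<Sum>a\<in>A. real (card {g \<in> ?C. g (e y x) = a})) \<le> real (card ?C)"
    by (simp only: of_nat_sum[symmetric] of_nat_le_iff)
  have "(\<Sum>a\<in>A. pending_weight n l N e B (insert x Z) (\<psi>(x := a)) y)
      = (\<Sum>a\<in>A. real (card {g \<in> ?C. g (e y x) = a})) * real n ^ Suc (card (N y \<inter> Z)) / real n ^ l y"
    unfolding pending_weight_def eq unfolding ins cins
    by (simp only: sum_distrib_right sum_divide_distrib)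
  also have "\<dots> \<le> real (card ?C) * real n ^ Suc (card (N y \<inter> Z)) / real n ^ l y"
    using le by (intro divide_right_mono mult_right_mono) auto
  also have "\<dots> = real n * pending_weight n l N e B Z \<psi> y"
    by (simp add: pending_weight_def)
  also have "\<dots> \<le> real (card A) * pending_weight n l N e B Z \<psi> y"
    using assms(2) pending_weight_nonneg by (intro mult_right_mono) auto
  finally show ?thesis .
qed

text \<open>Method of conditional expectations: vertices are placed by increasing level while the
  total weight stays below 1. A vertex left with too few candidates would alone have weight at least
  1.\<close>

lemma embed_levels:
  fixes c :: "'b set \<Rightarrow> nat" and X :: "nat \<Rightarrow> 'b set" and l :: "'a \<Rightarrow> nat"
  assumes Q: "finite Q" "card Q \<le> n" and n: "n \<ge> 1"
    and proper: "\<And>x y. x \<in> Q \<Longrightarrow> y \<in> Q \<Longrightarrow> {x, y} \<in> E \<Longrightarrow> l x \<noteq> l y"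
    and lower: "\<And>y. y \<in> Q \<Longrightarrow> card {x \<in> Q. {x, y} \<in> E \<and> l x < l y} \<le> l y"
    and fin: "\<And>j. finite (X j)"
    and mono: "mono X"
    and big: "card (X 0) \<ge> 2 * n"
    and few: "\<And>y. y \<in> Q \<Longrightarrow> n * card (bad_tuples c i (2 * n) (X (l y)) (X (l y - 1)) (l y)) < n ^ l y"
  shows "\<exists>\<phi>. inj_on \<phi> Q \<and> (\<forall>x\<in>Q. \<phi> x \<in> X (l x)) \<and>
    (\<forall>x\<in>Q. \<forall>y\<in>Q. {x, y} \<in> E \<longrightarrow> c {\<phi> x, \<phi> y} = i)"
proof -
  define N where "N y = {x \<in> Q. {x, y} \<in> E \<and> l x < l y}" for y
  have fN: "finite (N y)" for y using Q by (auto simp: N_def)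
  have "\<exists>e. inj_on e (N y) \<and> e ` N y \<subseteq> {..<l y}" if "y \<in> Q" for y
  proof -
    have "card (N y) \<le> card {..<l y}" using lower[OF that] by (simp add: N_def)
    then show ?thesis using card_le_inj[OF fN, of "{..<l y}" y] by auto
  qed
  then obtain e where e: "\<And>y. y \<in> Q \<Longrightarrow> inj_on (e y) (N y) \<and> e y ` N y \<subseteq> {..<l y}" by metis
  define B where "B y = bad_tuples c i (2 * n) (X (l y)) (X (l y - 1)) (l y)" for y
  have fB: "finite (B y)" for y using fin by (simp add: B_def finite_bad_tuples)
  let ?w = "pending_weight n l N e B"
  \<comment> \<open>Downward closure of \<open>Z\<close> in level ensures that no placed vertex lies
    above the next one.\<close>
  define ok where "ok Z \<psi> \<longleftrightarrow> Z \<subseteq> Q \<and> (\<forall>x\<in>Z. \<forall>y\<in>Q. l y < l x \<longrightarrow> y \<in> Z) \<and> inj_on \<psi> Z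
     \<and> (\<forall>x\<in>Z. \<psi> x \<in> X (l x)) \<and> (\<forall>x\<in>Z. \<forall>y\<in>Z. {x, y} \<in> E \<longrightarrow> c {\<psi> x, \<psi> y} = i)
     \<and> (\<Sum>y\<in>Q. ?w Z \<psi> y) < 1" for Z and \<psi> :: "'a \<Rightarrow> 'b"
  have start: "ok {} (\<lambda>_. undefined)"
  proof -
    have w: "real n * ?w {} (\<lambda>_. undefined) y < 1" if "y \<in> Q" for y
    proof -
      have "real n * real (card (B y)) < real n ^ l y"
        using few[OF that] by (simp only: B_def of_nat_mult[symmetric] of_nat_power[symmetric] of_nat_less_iff)
      then show ?thesis using n by (simp add: pending_weight_def divide_less_eq)
    qed
    have "(\<Sum>y\<in>Q. ?w {} (\<lambda>_. undefined) y) < 1"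
    proof (cases "Q = {}")
      case False
      have "real n * (\<Sum>y\<in>Q. ?w {} (\<lambda>_. undefined) y) < (\<Sum>y\<in>Q. 1)"
        unfolding sum_distrib_left using w Q False by (intro sum_strict_mono) auto
      also have "\<dots> \<le> real n" using Q by simp
      finally show ?thesis using n by simp
    qed simp
    then show ?thesis by (simp add: ok_def)
  qed
  have extend: "\<exists>x \<psi>'. x \<notin> Z \<and> ok (insert x Z) \<psi>'" if ok: "ok Z \<psi>" and ne: "Z \<noteq> Q" for Z \<psi>
  proof -
    have ZQ: "Z \<subseteq> Q" and down: "\<And>x y. x \<in> Z \<Longrightarrow> y \<in> Q \<Longrightarrow> l y < l x \<Longrightarrow> y \<in> Z"
      and inj: "inj_on \<psi> Z" and inX: "\<And>x. x \<in> Z \<Longrightarrow> \<psi> x \<in> X (l x)"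
      and col: "\<And>x y. x \<in> Z \<Longrightarrow> y \<in> Z \<Longrightarrow> {x, y} \<in> E \<Longrightarrow> c {\<psi> x, \<psi> y} = i"
      and wt: "(\<Sum>y\<in>Q. ?w Z \<psi> y) < 1"
      using ok unfolding ok_def by blast+
    obtain x where x: "x \<in> Q - Z" and xmin: "\<And>y. y \<in> Q - Z \<Longrightarrow> l x \<le> l y"
      using ex_min_if_finite[of "l ` (Q - Z)"] Q ZQ ne
      by (metis (no_types, lifting) Diff_eq_empty_iff arg_min_if_finite(1) arg_min_least finite_Diff subset_antisym)
    let ?s = "l x" and ?Y = "X (l x - 1)"
    have NZ: "N x \<subseteq> Z" using xmin by (fastforce simp: N_def)
    have NY: "\<psi> ` N x \<subseteq> ?Y"
    proof
      fix b assume "b \<in> \<psi> ` N x"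
      then obtain z where z: "z \<in> N x" "b = \<psi> z" by blast
      then have "l z \<le> l x - 1" by (auto simp: N_def)
      then show "b \<in> ?Y" using z inX NZ monoD[OF mono] by blast
    qed
    \<comment> \<open>Otherwise every completion of the image of \<open>N x\<close> to a tuple is
      bad, since more entries only shrink the common neighbourhood. These are at least
      \<open>n ^ (l x - card (N x))\<close> tuples, so \<open>x\<close> has weight at least
      1.\<close>
    have good: "2 * n \<le> card (common_nbhd c i (X ?s) (\<psi> ` N x))"
    proof (rule ccontr)
      assume "\<not> ?thesis"
      then have lt: "card (common_nbhd c i (X ?s) (\<psi> ` N x)) < 2 * n" by simp
      have "{g \<in> {..<?s} \<rightarrow>\<^sub>E ?Y. \<forall>z\<in>N x. g (e x z) = \<psi> z} \<subseteq> {g \<in> B x. \<forall>z\<in>N x \<inter> Z. g (e x z) = \<psi> z}"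
      proof
        fix g assume g: "g \<in> {g \<in> {..<?s} \<rightarrow>\<^sub>E ?Y. \<forall>z\<in>N x. g (e x z) = \<psi> z}"
        have "\<psi> ` N x \<subseteq> g ` {..<?s}"
        proof
          fix b assume "b \<in> \<psi> ` N x"
          then obtain z where "z \<in> N x" "b = g (e x z)" using g by auto
          then show "b \<in> g ` {..<?s}" using e[of x] x by blast
        qed
        then have "card (common_nbhd c i (X ?s) (g ` {..<?s})) \<le> card (common_nbhd c i (X ?s) (\<psi> ` N x))"
          using fin by (intro card_mono common_nbhd_antimono finite_subset[OF common_nbhd_subset]) auto
        then show "g \<in> {g \<in> B x. \<forall>z\<in>N x \<inter> Z. g (e x z) = \<psi> z}"
          using g lt by (auto simp: B_def bad_tuples_def)
      qed
      then have "card {g \<in> {..<?s} \<rightarrow>\<^sub>E ?Y. \<forall>z\<in>N x. g (e x z) = \<psi> z}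
          \<le> card {g \<in> B x. \<forall>z\<in>N x \<inter> Z. g (e x z) = \<psi> z}"
        using fB by (intro card_mono) auto
      then have "card ?Y ^ (?s - card (N x)) \<le> card {g \<in> B x. \<forall>z\<in>N x \<inter> Z. g (e x z) = \<psi> z}"
        using card_completions[OF fN, of "e x" x ?s \<psi> ?Y] e[of x] x NY fin by simp
      moreover have "n ^ (?s - card (N x)) \<le> card ?Y ^ (?s - card (N x))"
      proof -
        have "card (X 0) \<le> card ?Y" using fin monoD[OF mono] by (intro card_mono) auto
        then show ?thesis using big by (intro power_mono) auto
      qed
      ultimately have "n ^ (?s - card (N x)) \<le> card {g \<in> B x. \<forall>z\<in>N x \<inter> Z. g (e x z) = \<psi> z}" by simp
      then have le: "real n ^ (?s - card (N x)) \<le> real (card {g \<in> B x. \<forall>z\<in>N x \<inter> Z. g (e x z) = \<psi> z})"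
        by (simp only: of_nat_power[symmetric] of_nat_le_iff)
      have "real n ^ ?s = real n ^ (?s - card (N x)) * real n ^ card (N x)"
        using lower[of x] x by (simp add: N_def flip: power_add)
      also have "\<dots> \<le> real (card {g \<in> B x. \<forall>z\<in>N x \<inter> Z. g (e x z) = \<psi> z}) * real n ^ card (N x)"
        using le by (intro mult_right_mono) auto
      finally have "1 \<le> ?w Z \<psi> x"
        using NZ n by (simp add: pending_weight_def Int_absorb2)
      also have "\<dots> \<le> (\<Sum>y\<in>Q. ?w Z \<psi> y)"
        using Q x by (intro member_le_sum) (auto simp: pending_weight_nonneg)
      finally show False using wt by simp
    qed
    \<comment> \<open>At most \<open>n\<close> of at least \<open>2 * n\<close> candidates are used
      up. Avoiding used images also rules out the equality case of
      \<open>common_nbhd\<close>.\<close>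
    define A where "A = common_nbhd c i (X ?s) (\<psi> ` N x) - \<psi> ` Z"
    have fA: "finite A" using fin by (auto simp: A_def common_nbhd_def)
    have "card (\<psi> ` Z) \<le> n"
      using Q ZQ by (meson card_image_le card_mono finite_subset le_trans)
    then have nA: "n \<le> card A"
      using good diff_card_le_card_Diff[of "\<psi> ` Z" "common_nbhd c i (X ?s) (\<psi> ` N x)"] Q ZQ
      by (auto simp: A_def dest: finite_subset)
    have "\<exists>a\<in>A. (\<Sum>y\<in>Q. ?w (insert x Z) (\<psi>(x := a)) y) \<le> (\<Sum>y\<in>Q. ?w Z \<psi> y)"
    proof (rule ccontr)
      assume "\<not> ?thesis"
      then have "(\<Sum>a\<in>A. \<Sum>y\<in>Q. ?w Z \<psi> y) < (\<Sum>a\<in>A. \<Sum>y\<in>Q. ?w (insert x Z) (\<psi>(x := a)) y)"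
        using fA nA n by (intro sum_strict_mono[of A]) (fastforce simp: not_le)+
      also have "\<dots> = (\<Sum>y\<in>Q. \<Sum>a\<in>A. ?w (insert x Z) (\<psi>(x := a)) y)" by (rule sum.swap)
      also have "\<dots> \<le> (\<Sum>y\<in>Q. real (card A) * ?w Z \<psi> y)"
        using fA nA fB fN x by (intro sum_mono pending_weight_extend) auto
      also have "\<dots> = (\<Sum>a\<in>A. \<Sum>y\<in>Q. ?w Z \<psi> y)" by (simp add: sum_distrib_left)
      finally show False by simp
    qed
    then obtain a where a: "a \<in> A" "(\<Sum>y\<in>Q. ?w (insert x Z) (\<psi>(x := a)) y) < 1"
      using wt by fastforce
    have aZ: "a \<notin> \<psi> ` Z" and aX: "a \<in> X ?s" using a by (auto simp: A_def common_nbhd_def)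
    have acol: "c {a, \<psi> z} = i" if "z \<in> Z" "{x, z} \<in> E \<or> {z, x} \<in> E" for z
    proof -
      have zx: "{z, x} \<in> E" using that by (auto simp: insert_commute)
      \<comment> \<open>\<open>z\<close> is not above \<open>x\<close> by downward closure, nor on
        its level by \<open>proper\<close>.\<close>
      have "\<not> l x < l z" using down[OF that(1), of x] x by auto
      then have "z \<in> N x" using proper[OF _ _ zx] zx that ZQ x by (fastforce simp: N_def)
      moreover have "a \<noteq> \<psi> z" using aZ that by blast
      ultimately show ?thesis using a(1) by (auto simp: A_def common_nbhd_def)
    qed
    have nloop: "{x, x} \<notin> E" using proper[of x x] x by blast
    have "ok (insert x Z) (\<psi>(x := a))"
      unfolding ok_def
    proof (intro conjI)
      show "insert x Z \<subseteq> Q" using x ZQ by auto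
      show "\<forall>z\<in>insert x Z. \<forall>y\<in>Q. l y < l z \<longrightarrow> y \<in> insert x Z"
        using down xmin by (metis DiffI insert_iff leD)
      show "inj_on (\<psi>(x := a)) (insert x Z)"
        using inj aZ x by (auto simp: inj_on_def)
      show "\<forall>z\<in>insert x Z. (\<psi>(x := a)) z \<in> X (l z)" using inX aX x by auto
      show "\<forall>z\<in>insert x Z. \<forall>y\<in>insert x Z. {z, y} \<in> E \<longrightarrow> c {(\<psi>(x := a)) z, (\<psi>(x := a)) y} = i"
        using col acol nloop x by (auto simp: insert_commute)
      show "(\<Sum>y\<in>Q. ?w (insert x Z) (\<psi>(x := a)) y) < 1" by (rule a(2))
    qed
    then show ?thesis using x by blast
  qed
  have "\<exists>Z \<psi>. card Z = j \<and> ok Z \<psi>" if "j \<le> card Q" for j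
    using that
  proof (induction j)
    case 0
    show ?case using start by (metis card.empty)
  next
    case (Suc j)
    then obtain Z \<psi> where Z: "card Z = j" "ok Z \<psi>" by auto
    then have "Z \<noteq> Q" using Suc.prems by auto
    then obtain x \<psi>' where "x \<notin> Z" "ok (insert x Z) \<psi>'" using extend Z by blast
    moreover have "finite Z" using Z(2) Q by (auto simp: ok_def dest: finite_subset)
    ultimately show ?case using Z(1) by (intro exI[of _ "insert x Z"]) auto
  qed
  then obtain Z \<psi> where Z: "card Z = card Q" "ok Z \<psi>" by blast
  then have "Z = Q" using Q card_subset_eq[of Q Z] by (auto simp: ok_def)
  then show ?thesis using Z(2) unfolding ok_def by blast
qed

subsection \<open>Shrinking the vertex set\<close>

text \<open>In all that follows \<open>s\<close> counts the steps a colour has left: a chain goes from the start set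
  \<open>X L\<close> down to the current set \<open>X s\<close>, and \<open>X j\<close> arises in the step with \<open>Suc j\<close> steps left. Sets between
  two consecutive steps of the same colour are forgotten, since shrinking the target of a step
  keeps it valid.\<close>

definition step_cost :: "nat \<Rightarrow> nat \<Rightarrow> nat" where
  "step_cost d s = (if s \<le> d then Suc s else 1)"

text \<open>Multiplying by \<open>n\<close> avoids the exponent \<open>s - 1\<close>. Taking
  \<open>v\<close> outside \<open>Y\<close> keeps this host distinct from every image placed in
  \<open>Y\<close>.\<close>

definition colour_step :: "('b set \<Rightarrow> nat) \<Rightarrow> nat \<Rightarrow> nat \<Rightarrow> nat \<Rightarrow> nat \<Rightarrow> 'b set \<Rightarrow> 'b set \<Rightarrow> bool" where
  "colour_step c i d n s X Y \<longleftrightarrow> Y \<subseteq> X \<and>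
     (if s \<le> d then n * card (bad_tuples c i (2 * n) X Y s) < n ^ s
      else \<exists>v\<in>X - Y. \<forall>w\<in>Y. c {v, w} = i)"

text \<open>Values of \<open>X\<close> outside \<open>{s..L}\<close> are arbitrary, so a chain is
  extended or shrunk by updating one value.\<close>

definition colour_chain :: "('b set \<Rightarrow> nat) \<Rightarrow> nat \<Rightarrow> nat \<Rightarrow> nat \<Rightarrow> nat \<Rightarrow> 'b set \<Rightarrow> nat \<Rightarrow> 'b set \<Rightarrow> bool" where
  "colour_chain c i d n L U\<^sub>0 s U \<longleftrightarrow> (\<exists>X. X s = U \<and> X L \<subseteq> U\<^sub>0 \<and>
     (\<forall>j. s \<le> j \<and> j < L \<longrightarrow> colour_step c i d n (Suc j) (X (Suc j)) (X j)))"

lemma colour_step_shrink: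
  assumes "colour_step c i d n s X Y" "Y' \<subseteq> Y" "finite X"
  shows "colour_step c i d n s X Y'"
proof -
  have "finite (bad_tuples c i (2 * n) X Y s)"
    using assms by (intro finite_bad_tuples) (auto simp: colour_step_def dest: finite_subset)
  then have "card (bad_tuples c i (2 * n) X Y' s) \<le> card (bad_tuples c i (2 * n) X Y s)"
    using assms by (intro card_mono bad_tuples_mono) auto
  then have le: "n * card (bad_tuples c i (2 * n) X Y' s) \<le> n * card (bad_tuples c i (2 * n) X Y s)"
    by (rule mult_le_mono2)
  show ?thesis
  proof (cases "s \<le> d")
    case True
    then show ?thesis using assms le_less_trans[OF le] unfolding colour_step_def by auto
  next
    case False
    then show ?thesis using assms unfolding colour_step_def by auto
  qed
qed

lemma colour_chain_extend:
  assumes "colour_chain c i d n L U\<^sub>0 (Suc s) U" "Suc s \<le> L" "colour_step c i d n (Suc s) U U'"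
  shows "colour_chain c i d n L U\<^sub>0 s U'"
proof -
  obtain X where X: "X (Suc s) = U" "X L \<subseteq> U\<^sub>0"
    "\<And>j. Suc s \<le> j \<Longrightarrow> j < L \<Longrightarrow> colour_step c i d n (Suc j) (X (Suc j)) (X j)"
    using assms(1) unfolding colour_chain_def by blast
  have "colour_step c i d n (Suc j) ((X(s := U')) (Suc j)) ((X(s := U')) j)" if "s \<le> j" "j < L" for j
    using X assms(3) that by (cases "j = s") auto
  then show ?thesis unfolding colour_chain_def using X assms(2)
    by (intro exI[of _ "X(s := U')"]) auto
qed

lemma steps_subset_top:
  assumes X: "\<And>j. s \<le> j \<Longrightarrow> j < L \<Longrightarrow> colour_step c i d n (Suc j) (X (Suc j)) (X j)" and "s \<le> j" "j \<le> L"
  shows "X j \<subseteq> X L"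
  using assms(3,2)
proof (induction j rule: inc_induct)
  case (step j)
  then show ?case using X[of j] by (auto simp: colour_step_def)
qed simp

text \<open>For the colours that do not take the current step. The last set of a chain is the source
  of none of its steps, so replacing it changes at most one target.\<close>

lemma colour_chain_shrink:
  assumes "colour_chain c i d n L U\<^sub>0 s U" "s \<le> L" "U' \<subseteq> U" "finite U\<^sub>0"
  shows "colour_chain c i d n L U\<^sub>0 s U'"
proof -
  obtain X where X: "X s = U" "X L \<subseteq> U\<^sub>0"
    "\<And>j. s \<le> j \<Longrightarrow> j < L \<Longrightarrow> colour_step c i d n (Suc j) (X (Suc j)) (X j)"
    using assms(1) unfolding colour_chain_def by blast
  have "colour_step c i d n (Suc j) ((X(s := U')) (Suc j)) ((X(s := U')) j)" if "s \<le> j" "j < L" for j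
  proof (cases "j = s")
    case True
    have "X (Suc j) \<subseteq> X L" using steps_subset_top[where X=X and s=s and L=L, OF X(3)] that by simp
    then have "finite (X (Suc j))" using X(2) assms(4) by (meson finite_subset)
    then show ?thesis using True X that assms(3) colour_step_shrink by fastforce
  qed (use X that in auto)
  moreover have "(X(s := U')) L \<subseteq> U\<^sub>0" using X assms(2,3) by auto
  ultimately show ?thesis unfolding colour_chain_def
    by (intro exI[of _ "X(s := U')"]) auto
qed

text \<open>The summand \<open>slack\<close> absorbs the additive losses, so no step costs more than \<open>k\<^sup>s\<^sup>+\<^sup>1\<close> or \<open>k\<close>.\<close>

lemma dense_step:
  fixes c :: "'b set \<Rightarrow> nat"
  assumes U: "finite U" "U \<noteq> {}" and k: "k \<ge> 3" and n: "n \<ge> 1" and s: "s \<ge> 1"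
    and dense: "real (card U) * (real (card U) / real k) \<le> (\<Sum>v\<in>U. real (card (common_nbhd c i U {v})))"
    and slack: "slack = 9 / 8 * (2 ^ Suc d * real n ^ 2)"
  shows "\<exists>U'. colour_step c i d n s U U' \<and>
    real (card U) + slack \<le> real k ^ step_cost d s * (real (card U') + slack)"
proof (cases "s \<le> d")
  case True
  \<comment> \<open>One loss for all \<open>s \<le> d\<close>:
    \<open>(2 * n) ^ Suc s / n ^ (s - 1)\<close> equals \<open>2 ^ Suc s * n ^ 2\<close>.\<close>
  let ?loss = "2 ^ Suc d * real n ^ 2"
  have "real (2 * n) ^ Suc s = 2 ^ Suc s * (real n ^ 2 * real n ^ (s - 1))"
    using s by (simp add: power_mult_distrib flip: power_Suc power_add)
  also have "\<dots> \<le> 2 ^ Suc d * (real n ^ 2 * real n ^ (s - 1))"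
    using True by (intro mult_right_mono power_increasing) auto
  finally have "real (2 * n) ^ Suc s \<le> ?loss * real n ^ (s - 1)" by (simp add: mult.assoc)
  then obtain U' where U': "U' \<subseteq> U" "real (card U') \<ge> real (card U) / real k ^ Suc s - ?loss"
    "n * card (bad_tuples c i (2 * n) U U' s) < n ^ s"
    using dependent_random_choice[OF U(1) _ s n dense, of "2 * n" ?loss] k by auto
  have K: "real k ^ Suc s \<ge> 9"
  proof -
    have "(9::real) = 3 ^ 2" by simp
    also have "\<dots> \<le> 3 ^ Suc s" using s by (intro power_increasing) auto
    also have "\<dots> \<le> real k ^ Suc s" using k by (intro power_mono) auto
    finally show ?thesis .
  qed
  have "real (card U) / real k ^ Suc s \<le> real (card U') + ?loss" using U'(2) by simp
  then have "real (card U) \<le> (real (card U') + ?loss) * real k ^ Suc s"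
    using K by (subst (asm) pos_divide_le_eq) auto
  \<comment> \<open>With \<open>K = k ^ Suc s\<close>, the slack must be at least
    \<open>K / (K - 1)\<close> times the loss, and \<open>K \<ge> 9\<close> bounds this ratio by
    \<open>9 / 8\<close>.\<close>
  moreover have "?loss * real k ^ Suc s + slack \<le> real k ^ Suc s * slack"
  proof -
    have "9 * ?loss \<le> real k ^ Suc s * ?loss" using K by (intro mult_right_mono) auto
    then show ?thesis unfolding slack by (simp add: algebra_simps)
  qed
  ultimately have "real (card U) + slack \<le> real k ^ Suc s * (real (card U') + slack)"
    by (simp add: algebra_simps)
  then show ?thesis using U' True unfolding colour_step_def step_cost_def by auto
next
  case False
  obtain v U' where v: "v \<in> U" "U' \<subseteq> U - {v}" "real (card U') \<ge> real (card U) / real k - 1"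
    "\<forall>w\<in>U'. c {v, w} = i"
    using dense_vertex[OF U dense] by blast
  have "real (card U) / real k \<le> real (card U') + 1" using v(3) by simp
  then have 1: "real (card U) \<le> (real (card U') + 1) * real k"
    using k by (simp add: divide_le_eq)
  have "1 * 1 \<le> (2::real) ^ d * real n ^ 2"
    using n by (intro mult_mono) (auto simp: one_le_power)
  then have "slack \<ge> 2" unfolding slack by simp
  moreover have "3 * slack \<le> real k * slack" using k \<open>slack \<ge> 2\<close> by (intro mult_right_mono) auto
  moreover have "real k * 2 \<le> real k * slack" using \<open>slack \<ge> 2\<close> by (intro mult_left_mono) auto
  ultimately have "real k + slack \<le> real k * slack" by linarith
  with 1 have "real (card U) + slack \<le> real k ^ 1 * (real (card U') + slack)"
    by (simp add: algebra_simps)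
  then show ?thesis using v False unfolding colour_step_def step_cost_def by auto
qed

text \<open>Induction on the total number of steps left. The invariant is that
  \<open>card U + slack\<close> pays for all remaining steps of all colours and still leaves
  \<open>2 * n + slack\<close>. The process stops as soon as one colour has run out of
  steps.\<close>

lemma exists_colour_chain_aux:
  fixes c :: "'b set \<Rightarrow> nat" and \<sigma> :: "nat \<Rightarrow> nat"
  assumes U0: "finite U\<^sub>0" and k: "k \<ge> 3" and n: "n \<ge> 1"
    and c: "\<And>v w. v \<in> U\<^sub>0 \<Longrightarrow> w \<in> U\<^sub>0 \<Longrightarrow> v \<noteq> w \<Longrightarrow> c {v, w} < k"
    and slack: "slack = 9 / 8 * (2 ^ Suc d * real n ^ 2)"
    and "\<And>i. i < k \<Longrightarrow> \<sigma> i \<le> L" "\<And>i. i < k \<Longrightarrow> colour_chain c i d n L U\<^sub>0 (\<sigma> i) U" "U \<subseteq> U\<^sub>0"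
    and "real k ^ (\<Sum>i<k. \<Sum>s=1..\<sigma> i. step_cost d s) * (2 * real n + slack) \<le> real (card U) + slack"
  shows "\<exists>i<k. \<exists>U'. colour_chain c i d n L U\<^sub>0 0 U' \<and> 2 * n \<le> card U'"
  using assms(6-)
proof (induction "\<Sum>i<k. \<sigma> i" arbitrary: \<sigma> U rule: less_induct)
  case less
  let ?cost = "\<lambda>\<sigma>. \<Sum>i<k. \<Sum>s=1..\<sigma> i. step_cost d s"
  have slack0: "slack \<ge> 0" unfolding slack by simp
  have "1 * (2 * real n + slack) \<le> real k ^ ?cost \<sigma> * (2 * real n + slack)"
    using k slack0 by (intro mult_right_mono one_le_power) auto
  then have "real (2 * n) \<le> real (card U)" using less.prems(4) by simp
  then have size: "2 * n \<le> card U" by (simp only: of_nat_le_iff)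
  show ?case
  proof (cases "\<exists>i<k. \<sigma> i = 0")
    case True
    then show ?thesis using less.prems(2) size by metis
  next
    case False
    have fU: "finite U" using less.prems(3) U0 by (rule finite_subset)
    obtain i where i: "i < k"
      and dense: "real (card U) * (real (card U) / real k) \<le> (\<Sum>v\<in>U. real (card (common_nbhd c i U {v})))"
      using dense_colour[OF fU, of k c] c k less.prems(3) by (meson in_mono less_le_trans zero_less_numeral)
    define s where "s = \<sigma> i - 1"
    have s: "\<sigma> i = Suc s" using False i by (auto simp: s_def)
    have "U \<noteq> {}" using size n by auto
    then obtain U' where U': "colour_step c i d n (Suc s) U U'"
      "real (card U) + slack \<le> real k ^ step_cost d (Suc s) * (real (card U') + slack)"
      using dense_step[OF fU _ k n _ dense slack, of "Suc s"] by auto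
    have sub: "U' \<subseteq> U" using U' by (auto simp: colour_step_def)
    let ?\<sigma> = "\<sigma>(i := s)"
    have sum_upd: "(\<Sum>j<k. f (\<sigma> j)) = f (Suc s) + (\<Sum>j\<in>{..<k} - {i}. f (\<sigma> j))"
      "(\<Sum>j<k. f (?\<sigma> j)) = f s + (\<Sum>j\<in>{..<k} - {i}. f (\<sigma> j))" for f :: "nat \<Rightarrow> nat"
      using i s by (auto simp: sum.remove[of "{..<k}" i] intro!: sum.cong)
    have dec: "(\<Sum>j<k. ?\<sigma> j) < (\<Sum>j<k. \<sigma> j)"
      using sum_upd[of "\<lambda>x. x"] by simp
    have cost: "?cost \<sigma> = step_cost d (Suc s) + ?cost ?\<sigma>"
      using sum_upd[of "\<lambda>x. \<Sum>s=1..x. step_cost d s"] by simp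
    show ?thesis
    proof (rule less.hyps[OF dec])
      show "?\<sigma> j \<le> L" if "j < k" for j using less.prems(1)[of i] less.prems(1)[OF that] s i by auto
      show "colour_chain c j d n L U\<^sub>0 (?\<sigma> j) U'" if "j < k" for j
      proof (cases "j = i")
        case True
        then show ?thesis
          using colour_chain_extend[of c i d n L U\<^sub>0 s U U'] less.prems(1,2)[OF i] s U'(1) by simp
      next
        case F: False
        then show ?thesis
          using colour_chain_shrink[OF less.prems(2)[OF that] less.prems(1)[OF that] sub U0] by simp
      qed
      show "U' \<subseteq> U\<^sub>0" using sub less.prems(3) by blast
      have "real k ^ step_cost d (Suc s) * (real k ^ ?cost ?\<sigma> * (2 * real n + slack))
          \<le> real k ^ step_cost d (Suc s) * (real (card U') + slack)"
        using less.prems(4) U'(2) unfolding cost power_add by (simp add: mult.assoc)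
      then show "real k ^ ?cost ?\<sigma> * (2 * real n + slack) \<le> real (card U') + slack"
        using k by simp
    qed
  qed
qed

lemma exists_colour_chain:
  fixes c :: "'b set \<Rightarrow> nat"
  assumes U0: "finite U\<^sub>0" and k: "k \<ge> 3" and n: "n \<ge> 1"
    and c: "\<And>v w. v \<in> U\<^sub>0 \<Longrightarrow> w \<in> U\<^sub>0 \<Longrightarrow> v \<noteq> w \<Longrightarrow> c {v, w} < k"
    and slack: "slack = 9 / 8 * (2 ^ Suc d * real n ^ 2)"
    and size: "real k ^ (k * (\<Sum>s=1..L. step_cost d s)) * (2 * real n + slack) \<le> real (card U\<^sub>0) + slack"
  shows "\<exists>i<k. \<exists>U'. colour_chain c i d n L U\<^sub>0 0 U' \<and> 2 * n \<le> card U'"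
proof (rule exists_colour_chain_aux[where c = c and k = k and U = U\<^sub>0 and \<sigma> = "\<lambda>_. L", OF U0 k n _ slack])
  show "c {v, w} < k" if "v \<in> U\<^sub>0" "w \<in> U\<^sub>0" "v \<noteq> w" for v w using c that .
  show "colour_chain c i d n L U\<^sub>0 L U\<^sub>0" for i by (auto simp: colour_chain_def)
  show "real k ^ (\<Sum>i<k. \<Sum>s=1..L. step_cost d s) * (2 * real n + slack) \<le> real (card U\<^sub>0) + slack"
    using size by simp
qed auto

section \<open>Independent levels in a graph of bounded degree\<close>

text \<open>The level of a vertex is \<open>d\<close> minus its colour in a proper colouring with minimal colour sum; in
  such a colouring each vertex has a neighbour in every smaller colour.\<close>

lemma exists_levels:
  fixes Q :: "'a set"
  assumes Q: "finite Q" and E: "\<And>x. {x, x} \<notin> E"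
    and deg: "\<And>y. y \<in> Q \<Longrightarrow> card {x \<in> Q. {x, y} \<in> E} \<le> d"
  shows "\<exists>l :: 'a \<Rightarrow> nat. (\<forall>x\<in>Q. l x \<le> d) \<and> (\<forall>x\<in>Q. \<forall>y\<in>Q. {x, y} \<in> E \<longrightarrow> l x \<noteq> l y) \<and>
    (\<forall>y\<in>Q. card {x \<in> Q. {x, y} \<in> E \<and> l x < l y} \<le> l y)"
proof -
  define proper where "proper g \<longleftrightarrow> (\<forall>x\<in>Q. \<forall>y\<in>Q. {x, y} \<in> E \<longrightarrow> g x \<noteq> g y)" for g :: "'a \<Rightarrow> nat"
  obtain f :: "'a \<Rightarrow> nat" where "inj_on f Q" using finite_imp_inj_to_nat_seg[OF Q] by blast
  then have "proper f" using E by (auto simp: proper_def inj_on_def)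
  then obtain g where g: "proper g" and least: "\<And>h. proper h \<Longrightarrow> sum g Q \<le> sum h Q"
    using ex_has_least_nat[of proper f "\<lambda>g. sum g Q"] by blast
  have lower: "\<exists>x\<in>Q. {x, y} \<in> E \<and> g x = a" if "y \<in> Q" "a < g y" for y a
  proof (rule ccontr)
    assume no: "\<not> ?thesis"
    then have no': "\<forall>x\<in>Q. {y, x} \<in> E \<longrightarrow> g x \<noteq> a" by (auto simp: insert_commute)
    have "proper (g(y := a))" using g no no' E by (auto simp: proper_def)
    then have "sum g Q \<le> sum (g(y := a)) Q" by (rule least)
    moreover have "sum (g(y := a)) Q < sum g Q"
      using that Q by (intro sum_strict_mono_ex1) auto
    ultimately show False by simp
  qed
  \<comment> \<open>At least \<open>g y\<close> of the at most \<open>d\<close> neighbours of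
    \<open>y\<close> have smaller colours, so at most \<open>d - g y\<close> have larger ones, and
    larger colours become lower levels.\<close>
  have split: "g y + card {x \<in> Q. {x, y} \<in> E \<and> g y < g x} \<le> d" if y: "y \<in> Q" for y
  proof -
    have "{..<g y} \<subseteq> g ` {x \<in> Q. {x, y} \<in> E \<and> g x < g y}"
      using lower[OF y] by auto
    then have "card {..<g y} \<le> card {x \<in> Q. {x, y} \<in> E \<and> g x < g y}"
      using Q by (intro surj_card_le) auto
    moreover have "card {x \<in> Q. {x, y} \<in> E \<and> g x < g y} + card {x \<in> Q. {x, y} \<in> E \<and> g y < g x}
        = card ({x \<in> Q. {x, y} \<in> E \<and> g x < g y} \<union> {x \<in> Q. {x, y} \<in> E \<and> g y < g x})"
      using Q by (intro card_Un_disjoint[symmetric]) auto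
    moreover have "\<dots> \<le> card {x \<in> Q. {x, y} \<in> E}"
      using Q by (intro card_mono) auto
    ultimately show ?thesis using deg[OF y] by simp
  qed
  then have gd: "g y \<le> d" if "y \<in> Q" for y using that by (meson add_leD1)
  have eq: "{x \<in> Q. {x, y} \<in> E \<and> d - g x < d - g y} = {x \<in> Q. {x, y} \<in> E \<and> g y < g x}" if "y \<in> Q" for y
  proof -
    have "d - g x < d - g y \<longleftrightarrow> g y < g x" if "x \<in> Q" for x
      using gd[OF that] gd[OF \<open>y \<in> Q\<close>] by arith
    then show ?thesis by blast
  qed
  show ?thesis
  proof (intro exI[of _ "\<lambda>x. d - g x"] conjI ballI impI)
    fix x y assume "x \<in> Q" "y \<in> Q" "{x, y} \<in> E"
    then have "g x \<noteq> g y" "g x \<le> d" "g y \<le> d" using g gd by (auto simp: proper_def)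
    then show "d - g x \<noteq> d - g y" by arith
  next
    fix y assume "y \<in> Q"
    then show "card {x \<in> Q. {x, y} \<in> E \<and> d - g x < d - g y} \<le> d - g y"
      using split[of y] by (simp only: eq) simp
  qed simp
qed

subsection \<open>The Ramsey bound\<close>

text \<open>Vertices outside \<open>H\<close> are placed in \<open>X 0\<close> up to
  \<open>X d\<close> by \<open>embed_levels\<close>. Each \<open>j\<close> with \<open>d < j\<close>
  and \<open>j \<le> L\<close> supplies a host for one vertex of \<open>H\<close>, joined in colour
  \<open>i\<close> to all of \<open>X (j - 1)\<close>, which contains everything placed at lower
  levels.\<close>

lemma embed_colour_chain:
  fixes c :: "'b set \<Rightarrow> nat" and V :: "'a set"
  assumes V: "finite V" "card V \<le> n" and n: "n \<ge> 1" and E: "\<And>x. {x, x} \<notin> E"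
    and H: "H = {y \<in> V. d < card {x \<in> V. {x, y} \<in> E}}"
    and ch: "colour_chain c i d n (d + card H) U\<^sub>0 0 U" and U0: "finite U\<^sub>0" and size: "2 * n \<le> card U"
  shows "\<exists>\<phi>. inj_on \<phi> V \<and> \<phi> ` V \<subseteq> U\<^sub>0 \<and> (\<forall>x\<in>V. \<forall>y\<in>V. {x, y} \<in> E \<longrightarrow> c {\<phi> x, \<phi> y} = i)"
proof -
  define L where "L = d + card H"
  define Q where "Q = V - H"
  have fH: "finite H" using V H by auto
  obtain X' where "X' 0 = U \<and> X' L \<subseteq> U\<^sub>0 \<and>
      (\<forall>j. 0 \<le> j \<and> j < L \<longrightarrow> colour_step c i d n (Suc j) (X' (Suc j)) (X' j))"
    using ch unfolding colour_chain_def L_def by (elim exE)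
  then have X': "X' 0 = U" "X' L \<subseteq> U\<^sub>0"
    "\<And>j. j < L \<Longrightarrow> colour_step c i d n (Suc j) (X' (Suc j)) (X' j)"
    by auto
  \<comment> \<open>Freezing the chain above \<open>L\<close> makes \<open>X\<close> monotone on all
    of \<open>nat\<close>.\<close>
  define X where "X j = X' (min j L)" for j
  have step: "colour_step c i d n j (X j) (X (j - 1))" if "0 < j" "j \<le> L" for j
    using X'(3)[of "j - 1"] that by (cases j) (auto simp: X_def min_def)
  have mono: "mono X"
    unfolding mono_iff_le_Suc
  proof
    fix j show "X j \<le> X (Suc j)"
      using step[of "Suc j"] by (cases "j < L") (auto simp: colour_step_def X_def min_def)
  qed
  have XU: "X j \<subseteq> U\<^sub>0" for j
  proof -
    have "X j \<subseteq> X (max j L)" by (rule monoD[OF mono]) simp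
    then show ?thesis using X'(2) by (simp add: X_def)
  qed
  then have fX: "finite (X j)" for j using U0 by (meson finite_subset)
  have big: "2 * n \<le> card (X 0)" using X'(1) size by (simp add: X_def)
  have fQ: "finite Q" "card Q \<le> n"
    using V card_mono[OF V(1), of Q] by (auto simp: Q_def)
  have "card {x \<in> Q. {x, y} \<in> E} \<le> d" if "y \<in> Q" for y
  proof -
    have "card {x \<in> Q. {x, y} \<in> E} \<le> card {x \<in> V. {x, y} \<in> E}"
      using V by (intro card_mono) (auto simp: Q_def)
    then show ?thesis using that by (auto simp: Q_def H not_less)
  qed
  then have "\<exists>l :: 'a \<Rightarrow> nat. (\<forall>x\<in>Q. l x \<le> d) \<and> (\<forall>x\<in>Q. \<forall>y\<in>Q. {x, y} \<in> E \<longrightarrow> l x \<noteq> l y) \<and>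
    (\<forall>y\<in>Q. card {x \<in> Q. {x, y} \<in> E \<and> l x < l y} \<le> l y)"
    by (intro exists_levels fQ(1) E)
  then obtain l :: "'a \<Rightarrow> nat" where l: "(\<forall>x\<in>Q. l x \<le> d) \<and> (\<forall>x\<in>Q. \<forall>y\<in>Q. {x, y} \<in> E \<longrightarrow> l x \<noteq> l y) \<and>
    (\<forall>y\<in>Q. card {x \<in> Q. {x, y} \<in> E \<and> l x < l y} \<le> l y)"
    by (elim exE)
  have ld: "l x \<le> d" if "x \<in> Q" for x using l that by blast
  have proper: "l x \<noteq> l y" if "x \<in> Q" "y \<in> Q" "{x, y} \<in> E" for x y using l that by blast
  have lower: "card {x \<in> Q. {x, y} \<in> E \<and> l x < l y} \<le> l y" if "y \<in> Q" for y using l that by blast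
  have few: "n * card (bad_tuples c i (2 * n) (X (l y)) (X (l y - 1)) (l y)) < n ^ l y" if "y \<in> Q" for y
  proof (cases "l y = 0")
    case True
    \<comment> \<open>At level 0 truncated subtraction yields \<open>X 0\<close> twice; the only
      tuple is the empty one, and \<open>big\<close> says that it is not bad.\<close>
    have "common_nbhd c i (X 0) {} = X 0" by (simp add: common_nbhd_def)
    then have "bad_tuples c i (2 * n) (X 0) (X 0) 0 = {}"
      using big by (simp add: bad_tuples_def)
    then show ?thesis using True by simp
  next
    case False
    then show ?thesis using step[of "l y"] ld[OF that] by (simp add: colour_step_def L_def)
  qed
  have "\<exists>\<psi>. inj_on \<psi> Q \<and> (\<forall>x\<in>Q. \<psi> x \<in> X (l x)) \<and>
      (\<forall>x\<in>Q. \<forall>y\<in>Q. {x, y} \<in> E \<longrightarrow> c {\<psi> x, \<psi> y} = i)"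
    by (rule embed_levels[OF fQ n proper lower fX mono big few])
  then obtain \<psi> where \<psi>: "inj_on \<psi> Q" "\<And>x. x \<in> Q \<Longrightarrow> \<psi> x \<in> X (l x)"
    "\<And>x y. x \<in> Q \<Longrightarrow> y \<in> Q \<Longrightarrow> {x, y} \<in> E \<Longrightarrow> c {\<psi> x, \<psi> y} = i"
    by blast
  have "\<exists>v. v \<in> X j - X (j - 1) \<and> (\<forall>w\<in>X (j - 1). c {v, w} = i)" if "d < j" "j \<le> L" for j
    using step[of j] that unfolding colour_step_def by auto
  then obtain v where v: "\<And>j. d < j \<Longrightarrow> j \<le> L \<Longrightarrow> v j \<in> X j - X (j - 1) \<and> (\<forall>w\<in>X (j - 1). c {v j, w} = i)"
    by metis
  obtain f where "bij_betw f H {0..<card H}" using ex_bij_betw_finite_nat[OF fH] by blast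
  then have f: "inj_on f H" "\<And>y. y \<in> H \<Longrightarrow> f y < card H" by (auto simp: bij_betw_def)
  \<comment> \<open>The vertices of \<open>H\<close> get distinct levels above \<open>d\<close>. Of
    two vertices not both in \<open>Q\<close>, the one of higher level then lies in \<open>H\<close>
    and its host sees the other.\<close>
  define lev where "lev x = (if x \<in> Q then l x else Suc (d + f x))" for x
  define \<phi> where "\<phi> x = (if x \<in> Q then \<psi> x else v (lev x))" for x
  have levH: "d < lev y" "lev y \<le> L" if "y \<in> H" for y
    using that f(2)[OF that] by (auto simp: lev_def Q_def L_def)
  have levQ: "lev x \<le> d" if "x \<in> Q" for x
    using ld[OF that] that by (simp add: lev_def)
  have VQ: "x \<in> Q \<or> x \<in> H" if "x \<in> V" for x using that by (simp add: Q_def)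
  have \<phi>X: "\<phi> x \<in> X (lev x)" if "x \<in> V" for x
    using that \<psi>(2) v[OF levH] by (cases "x \<in> Q") (auto simp: \<phi>_def lev_def Q_def)
  have up: "\<phi> x \<noteq> \<phi> y \<and> c {\<phi> x, \<phi> y} = i" if "x \<in> V" "y \<in> V" "y \<notin> Q" "lev x < lev y" for x y
  proof -
    have yH: "y \<in> H" using that by (auto simp: Q_def)
    have "X (lev x) \<subseteq> X (lev y - 1)" using that by (intro monoD[OF mono]) auto
    then have "\<phi> x \<in> X (lev y - 1)" using \<phi>X that by blast
    moreover have "\<phi> y = v (lev y)" using that by (simp add: \<phi>_def)
    ultimately show ?thesis using v[OF levH[OF yH]] by (auto simp: insert_commute)
  qed
  have main: "\<phi> x \<noteq> \<phi> y \<and> ({x, y} \<in> E \<longrightarrow> c {\<phi> x, \<phi> y} = i)" if xy: "x \<in> V" "y \<in> V" "x \<noteq> y" for x y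
  proof (cases "x \<in> Q \<and> y \<in> Q")
    case True
    then show ?thesis using \<psi> xy by (auto simp: \<phi>_def inj_on_def)
  next
    case F: False
    have yQ: "x \<in> Q \<Longrightarrow> y \<in> H" "y \<in> Q \<Longrightarrow> x \<in> H" using F VQ xy by blast+
    have cross: "x \<in> Q \<Longrightarrow> lev x < lev y" "y \<in> Q \<Longrightarrow> lev y < lev x"
      using levQ[of x] levQ[of y] levH(1)[OF yQ(1)] levH(1)[OF yQ(2)] by linarith+
    have "lev x \<noteq> lev y"
    proof
      assume eq: "lev x = lev y"
      then have "x \<notin> Q" "y \<notin> Q" using cross by auto
      then have "x \<in> H" "y \<in> H" "f x = f y" using VQ xy eq by (auto simp: lev_def)
      then show False using xy f(1) by (auto dest: inj_onD)
    qed
    moreover have "lev x < lev y \<Longrightarrow> y \<notin> Q" "lev y < lev x \<Longrightarrow> x \<notin> Q"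
      using cross by auto
    ultimately show ?thesis
      using up[of x y] up[of y x] xy by (metis insert_commute nat_neq_iff)
  qed
  show ?thesis
  proof (intro exI[of _ \<phi>] conjI ballI impI)
    show "inj_on \<phi> V" using main by (auto simp: inj_on_def)
    show "\<phi> ` V \<subseteq> U\<^sub>0" using \<phi>X XU by blast
    show "c {\<phi> x, \<phi> y} = i" if "x \<in> V" "y \<in> V" "{x, y} \<in> E" for x y
      using main[OF that(1,2)] that E by blast
  qed
qed

lemma sum_degrees:
  assumes "simple_graph V E"
  shows "(\<Sum>v\<in>V. card {u \<in> V. {u, v} \<in> E}) = 2 * card E"
proof -
  have V: "finite V" and E: "E \<subseteq> nsets V 2" using assms by (auto simp: simple_graph_def)
  then have fE: "finite E" by (meson finite_imp_finite_nsets finite_subset)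
  have "card {u \<in> V. {u, v} \<in> E} = card {e \<in> E. v \<in> e}" if "v \<in> V" for v
  proof (rule bij_betw_same_card[of "\<lambda>u. {u, v}"], rule bij_betwI')
    show "{x, v} = {y, v} \<longleftrightarrow> x = y" if "x \<in> {u \<in> V. {u, v} \<in> E}" "y \<in> {u \<in> V. {u, v} \<in> E}" for x y
      using that E by (auto simp: nsets_def doubleton_eq_iff)
    show "{x, v} \<in> {e \<in> E. v \<in> e}" if "x \<in> {u \<in> V. {u, v} \<in> E}" for x using that by simp
    show "\<exists>x\<in>{u \<in> V. {u, v} \<in> E}. e = {x, v}" if "e \<in> {e \<in> E. v \<in> e}" for e
    proof -
      have "e \<in> nsets V 2" using that E by blast
      then obtain a b where "e = {a, b}" "a \<in> V" "b \<in> V"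
        by (auto simp: nsets_def card_2_iff)
      then show ?thesis using that by (auto simp: insert_commute)
    qed
  qed
  then have "(\<Sum>v\<in>V. card {u \<in> V. {u, v} \<in> E}) = (\<Sum>v\<in>V. card {e \<in> E. v \<in> e})"
    by simp
  also have "\<dots> = (\<Sum>e\<in>E. card {v \<in> V. v \<in> e})" by (rule sum_card_swap[OF V fE])
  also have "\<dots> = (\<Sum>e\<in>E. 2)"
  proof (intro sum.cong refl)
    fix e assume "e \<in> E"
    then have "e \<subseteq> V" "card e = 2" using E by (auto simp: nsets_def)
    moreover have "{v \<in> V. v \<in> e} = e" using \<open>e \<subseteq> V\<close> by blast
    ultimately show "card {v \<in> V. v \<in> e} = 2" by simp
  qed
  finally show ?thesis by simp
qed

lemma ramsey_arrowI:
  fixes V :: "'a set"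
  assumes G: "simple_graph V E"
    and emb: "\<And>c. c \<in> nsets {..<N} 2 \<rightarrow> {..<k} \<Longrightarrow> \<exists>i<k. \<exists>\<phi>. inj_on \<phi> V \<and> \<phi> ` V \<subseteq> {..<N} \<and>
      (\<forall>x\<in>V. \<forall>y\<in>V. {x, y} \<in> E \<longrightarrow> c {\<phi> x, \<phi> y} = i)"
  shows "ramsey_arrow N k V E"
  unfolding ramsey_arrow_def
proof
  fix c :: "nat set \<Rightarrow> nat"
  assume "c \<in> nsets {..<N} 2 \<rightarrow> {..<k}"
  then have "\<exists>i<k. \<exists>\<phi>. inj_on \<phi> V \<and> \<phi> ` V \<subseteq> {..<N} \<and>
      (\<forall>x\<in>V. \<forall>y\<in>V. {x, y} \<in> E \<longrightarrow> c {\<phi> x, \<phi> y} = i)"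
    by (rule emb)
  then obtain i \<phi> where i: "i < k" and inj: "inj_on \<phi> V" and im: "\<phi> ` V \<subseteq> {..<N}"
    and col: "\<forall>x\<in>V. \<forall>y\<in>V. {x, y} \<in> E \<longrightarrow> c {\<phi> x, \<phi> y} = i"
    by (elim exE conjE)
  have V: "finite V" and E: "E \<subseteq> nsets V 2" using G by (auto simp: simple_graph_def)
  let ?D = "(\<lambda>e. \<phi> ` e) ` E"
  have edge: "\<exists>x y. e = {x, y} \<and> x \<in> V \<and> y \<in> V \<and> x \<noteq> y" if "e \<in> E" for e
    using that E by (fastforce simp: nsets_def card_2_iff)
  have D: "?D \<subseteq> nsets (\<phi> ` V) 2"
  proof
    fix e' assume "e' \<in> ?D"
    then obtain e where e: "e \<in> E" "e' = \<phi> ` e" by (elim imageE)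
    obtain x y where xy: "e = {x, y}" "x \<in> V" "y \<in> V" "x \<noteq> y" using edge[OF e(1)] by (elim exE conjE)
    then have "\<phi> x \<noteq> \<phi> y" using inj by (simp add: inj_on_eq_iff)
    then show "e' \<in> nsets (\<phi> ` V) 2" using e xy by (auto simp: nsets_def)
  qed
  have "{u, v} \<in> E \<longleftrightarrow> {\<phi> u, \<phi> v} \<in> ?D" if uv: "u \<in> V" "v \<in> V" for u v
  proof
    assume "{u, v} \<in> E"
    then show "{\<phi> u, \<phi> v} \<in> ?D" using imageI[of "{u, v}" E "\<lambda>e. \<phi> ` e"] by simp
  next
    assume "{\<phi> u, \<phi> v} \<in> ?D"
    then obtain e where e: "e \<in> E" "\<phi> ` {u, v} = \<phi> ` e" by (elim imageE) simp
    then have "e \<subseteq> V" using edge by blast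
    then have "{u, v} = e" using e(2) inj_on_image_eq_iff[OF inj, of "{u, v}" e] uv by simp
    then show "{u, v} \<in> E" using e by simp
  qed
  then have "graph_isomorphic V E (\<phi> ` V) ?D"
    using inj unfolding graph_isomorphic_def by (blast intro: inj_on_imp_bij_betw)
  moreover have "subgraph_of (\<phi> ` V) ?D {..<N} (nsets {..<N} 2)"
    using V D im nsets_mono[OF im, of 2] unfolding subgraph_of_def simple_graph_def by blast
  moreover have "\<forall>e\<in>?D. c e = i"
  proof
    fix e' assume "e' \<in> ?D"
    then obtain e where e: "e \<in> E" "e' = \<phi> ` e" by (elim imageE)
    obtain x y where "e = {x, y}" "x \<in> V" "y \<in> V" using edge[OF e(1)] by (elim exE conjE)
    then show "c e' = i" using e col by simp
  qed
  ultimately show "\<exists>W D. \<exists>i<k. subgraph_of W D {..<N} (nsets {..<N} 2) \<and>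
      graph_isomorphic V E W D \<and> (\<forall>e\<in>D. c e = i)"
    using i by blast
qed

lemma sum_step_cost: "2 * (\<Sum>s=1..d + h. step_cost d s) = 2 * h + d * (d + 3)"
proof (induction h)
  case 0
  have "2 * (\<Sum>s=1..d. Suc s) = d * (d + 3)" by (induction d) (auto simp: algebra_simps)
  moreover have "(\<Sum>s=1..d. step_cost d s) = (\<Sum>s=1..d. Suc s)"
    by (intro sum.cong) (auto simp: step_cost_def)
  ultimately show ?case by simp
next
  case (Suc h)
  then show ?case by (simp add: step_cost_def)
qed

text \<open>The threshold stays free. \<open>bound\<close> ranges over \<open>h\<close> because the
  number of vertices of degree above \<open>d\<close> is controlled only through the degree sum.
  Without isolated vertices \<open>card V \<le> 2 * m\<close>, hence
  \<open>n = 2 * m\<close>.\<close>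

lemma multicolor_ramsey_le:
  fixes V :: "'a set" and E :: "'a set set" and m k :: nat and R :: real
  assumes G: "simple_graph V E" and m: "card E = m" "m \<ge> 1"
    and iso: "\<nexists>v. isolated_vertex V E v" and k: "k \<ge> 3"
    and bound: "\<And>h e. h * Suc d \<le> 2 * m \<Longrightarrow> 2 * e = 2 * h + d * (d + 3) \<Longrightarrow>
      real k ^ (k * e) * (4 * real m + 9 / 8 * (2 ^ Suc d * (2 * real m) ^ 2)) \<le> R"
  shows "real (multicolor_ramsey k V E) \<le> R"
proof -
  define N where "N = nat \<lfloor>R\<rfloor>"
  let ?deg = "\<lambda>v. card {u \<in> V. {u, v} \<in> E}"
  define H where "H = {y \<in> V. d < ?deg y}"
  have V: "finite V" and E: "E \<subseteq> nsets V 2" using G by (auto simp: simple_graph_def)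
  have noloop: "{x, x} \<notin> E" for x using E by (auto simp: nsets_def)
  have "card H * Suc d = (\<Sum>v\<in>H. Suc d)" by simp
  also have "\<dots> \<le> (\<Sum>v\<in>H. ?deg v)" by (intro sum_mono) (auto simp: H_def)
  also have "\<dots> \<le> (\<Sum>v\<in>V. ?deg v)" using V by (intro sum_mono2) (auto simp: H_def)
  finally have H: "card H * Suc d \<le> 2 * m" using sum_degrees[OF G] m by simp
  have deg: "1 \<le> ?deg v" if "v \<in> V" for v
  proof -
    obtain e where "e \<in> E" "v \<in> e" using iso \<open>v \<in> V\<close> by (auto simp: isolated_vertex_def)
    moreover have "e \<in> nsets V 2" using \<open>e \<in> E\<close> E by blast
    then obtain a b where "e = {a, b}" "a \<in> V" "b \<in> V"
      by (auto simp: nsets_def card_2_iff)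
    ultimately have "{u \<in> V. {u, v} \<in> E} \<noteq> {}" by (auto simp: insert_commute)
    then show ?thesis using V by (simp add: Suc_le_eq card_gt_0_iff)
  qed
  have "card V = (\<Sum>v\<in>V. 1)" by simp
  also have "\<dots> \<le> (\<Sum>v\<in>V. ?deg v)" by (intro sum_mono deg)
  finally have cV: "card V \<le> 2 * m" using sum_degrees[OF G] m by simp
  define slack where "slack = 9 / 8 * (2 ^ Suc d * real (2 * m) ^ 2)"
  let ?e = "\<Sum>s=1..d + card H. step_cost d s"
  have "real k ^ (k * ?e) * (2 * real (2 * m) + slack) \<le> R"
    using bound[OF H sum_step_cost] by (simp add: slack_def)
  moreover have "0 \<le> real k ^ (k * ?e) * (2 * real (2 * m) + slack)" by (simp add: slack_def)
  ultimately have R: "real k ^ (k * ?e) * (2 * real (2 * m) + slack) \<le> R" "0 \<le> R" by linarith+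
  then have N: "real N \<le> R" "R < real N + 1" by (simp_all add: N_def)
  \<comment> \<open>Rounding \<open>R\<close> down to \<open>N\<close> loses less than 1, which the
    slack covers.\<close>
  have "1 * 1 \<le> 2 ^ Suc d * real (2 * m) ^ 2"
    using m by (intro mult_mono one_le_power) auto
  then have "slack \<ge> 1" by (simp add: slack_def)
  with R N have size: "real k ^ (k * ?e) * (2 * real (2 * m) + slack) \<le> real (card {..<N}) + slack" by simp
  have "ramsey_arrow N k V E"
  proof (rule ramsey_arrowI[OF G])
    fix c :: "nat set \<Rightarrow> nat" assume "c \<in> nsets {..<N} 2 \<rightarrow> {..<k}"
    then have c: "c {v, w} < k" if "v \<in> {..<N}" "w \<in> {..<N}" "v \<noteq> w" for v w
      using that by (auto simp: nsets_def Pi_iff)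
    obtain i U where "i < k" "colour_chain c i d (2 * m) (d + card H) {..<N} 0 U" "2 * (2 * m) \<le> card U"
      using exists_colour_chain[where c = c and k = k and U\<^sub>0 = "{..<N}", OF _ k _ c slack_def size] m
      by auto
    then show "\<exists>i<k. \<exists>\<phi>. inj_on \<phi> V \<and> \<phi> ` V \<subseteq> {..<N} \<and>
        (\<forall>x\<in>V. \<forall>y\<in>V. {x, y} \<in> E \<longrightarrow> c {\<phi> x, \<phi> y} = i)"
      using embed_colour_chain[OF V cV _ noloop H_def] m by fastforce
  qed
  then have "multicolor_ramsey k V E \<le> N" unfolding multicolor_ramsey_def by (rule Least_le)
  then show ?thesis using N by linarith
qed

subsection \<open>Optimising the degree threshold\<close>

lemma le_powr_inverse:
  fixes a b :: real
  assumes "0 < a" "a ^ n \<le> b" "n > 0"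
  shows "a \<le> b powr (1 / real n)"
proof -
  have "a = (a ^ n) powr (1 / real n)"
    using assms by (simp add: powr_powr flip: powr_realpow)
  also have "\<dots> \<le> b powr (1 / real n)" using assms by (intro powr_mono2) auto
  finally show ?thesis .
qed

text \<open>From \<open>D\<close> to \<open>D + 1\<close> the term with the cube grows at most by
  the factor \<open>2 * (5 / 4) ^ 3\<close>, which is below 5. The constants 5 and
  \<open>17 / 10\<close> are lower bounds for \<open>27 powr (1 / 2)\<close> and
  \<open>27 powr (1 / 6)\<close>.\<close>

lemma exponential_bound:
  fixes D :: nat
  assumes "D \<ge> 3"
  shows "1 / 2 + 9 / 32 * (2 ^ D * (real D + 1) ^ 3) \<le> 17 / 10 * 5 ^ D"
  using assms
proof (induction D rule: nat_induct_at_least)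
  case base
  then show ?case by (simp add: power3_eq_cube)
next
  case (Suc D)
  have "real D + 2 \<le> 5 / 4 * (real D + 1)" using Suc by simp
  then have "(real D + 2) ^ 3 \<le> (5 / 4 * (real D + 1)) ^ 3" by (intro power_mono) auto
  also have "\<dots> = 125 / 64 * (real D + 1) ^ 3" unfolding power_mult_distrib by (simp add: power3_eq_cube)
  also have "\<dots> \<le> 5 / 2 * (real D + 1) ^ 3" by (intro mult_right_mono) auto
  finally have "2 ^ D * (real D + 2) ^ 3 \<le> 2 ^ D * (5 / 2 * (real D + 1) ^ 3)" by (intro mult_left_mono) auto
  also have "\<dots> = 5 / 2 * (2 ^ D * (real D + 1) ^ 3)" by simp
  finally have "1 / 2 + 9 / 16 * (2 ^ D * (real D + 2) ^ 3) \<le> 17 / 10 * (5 * 5 ^ D)"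
    using Suc.IH by linarith
  moreover have "real (Suc D) + 1 = real D + 2" by simp
  ultimately show ?case by (simp add: add.commute)
qed

text \<open>\<open>h\<close> is replaced by its upper bound \<open>x ^ 3 / D\<close>; after
  expanding in \<open>\<eta>\<close> the terms in \<open>D ^ 2\<close> and \<open>D * \<eta>\<close>
  cancel.\<close>

lemma exponent_gap:
  fixes x :: real and D h e :: nat
  assumes D: "D \<ge> 1" and h: "real h * real D \<le> x ^ 3"
    and e: "2 * real e = 2 * real h + (real D - 1) * (real D + 2)"
    and \<eta>: "x = real D + \<eta>"
  shows "3 / 2 * x ^ 2 + x - real e \<ge> real D / 2 + 1 + \<eta> - 3 / 2 * \<eta> ^ 2 - \<eta> ^ 3 / real D"
proof -
  have "real h \<le> x ^ 3 / real D" using h D by (simp add: pos_le_divide_eq)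
  also have "\<dots> = real D ^ 2 + 3 * real D * \<eta> + 3 * \<eta> ^ 2 + \<eta> ^ 3 / real D"
    using D by (simp add: \<eta> field_simps power2_eq_square power3_eq_cube)
  finally show ?thesis using e unfolding \<eta> by (simp add: field_simps power2_eq_square)
qed

text \<open>The surplus \<open>S\<close> per colour is about \<open>x / 2\<close>, and \<open>27 = 3 ^ 3\<close> is the least value of \<open>k ^ k\<close>. For
  \<open>D \<le> 2\<close> the estimate \<open>\<eta> < 1\<close> is too weak; there one uses that \<open>x ^ 3\<close> is an even integer.\<close>

lemma loss_le_slack:
  fixes m D h e :: nat and x :: real
  assumes m: "m \<ge> 1" and D: "D \<ge> 1" and x: "x ^ 3 = 2 * real m" "real D \<le> x" "x < real D + 1"
    and h: "h * D \<le> 2 * m" and e: "2 * real e = 2 * real h + (real D - 1) * (real D + 2)"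
  defines "S \<equiv> 3 / 2 * x ^ 2 + x - real e"
  shows "S \<ge> 0" "1 / 2 + 9 / 16 * (2 ^ D * real m) \<le> 27 powr S"
proof -
  define \<eta> where "\<eta> = x - real D"
  have \<eta>: "0 \<le> \<eta>" "\<eta> < 1" using x by (auto simp: \<eta>_def)
  have "real (h * D) \<le> real (2 * m)" using h by (simp only: of_nat_le_iff)
  then have "real h * real D \<le> x ^ 3" using x by simp
  then have S: "S \<ge> real D / 2 + 1 + \<eta> - 3 / 2 * \<eta> ^ 2 - \<eta> ^ 3 / real D"
    unfolding S_def using D e by (intro exponent_gap) (auto simp: \<eta>_def)
  have "x ^ 3 < (real D + 1) ^ 3" using x by (intro power_strict_mono) auto
  then have m_less: "2 * real m < (real D + 1) ^ 3" using x by simp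
  have poly: "3 / 2 * \<eta> ^ 2 + \<eta> ^ 3 / real D \<le> (3 / 2 * b + b ^ 2 / real D) * \<eta>" if "\<eta> \<le> b" for b
  proof -
    have "\<eta> ^ 2 \<le> b * \<eta>" using that \<eta> by (simp add: power2_eq_square mult_right_mono)
    moreover have "\<eta> ^ 3 \<le> b ^ 2 * \<eta>"
    proof -
      have "\<eta> ^ 2 * \<eta> \<le> b ^ 2 * \<eta>" using that \<eta> by (intro mult_right_mono power_mono) auto
      then show ?thesis by (simp add: power2_eq_square power3_eq_cube)
    qed
    then have "\<eta> ^ 3 / real D \<le> b ^ 2 * \<eta> / real D" by (intro divide_right_mono) auto
    ultimately show ?thesis by (simp add: algebra_simps)
  qed
  consider "D = 1" | "D = 2" | "D \<ge> 3" using D by linarith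
  then have "S \<ge> 0 \<and> 1 / 2 + 9 / 16 * (2 ^ D * real m) \<le> 27 powr S"
  proof cases
    case 1
    then have m3: "m \<le> 3" using m_less by simp
    \<comment> \<open>Just above the cube root of 6, the largest possible \<open>x ^ 3\<close> here;
      for \<open>D = 2\<close> the bound 2.97 likewise exceeds the cube root of 26.\<close>
    have "x \<le> 1.82"
    proof (rule ccontr)
      assume "\<not> ?thesis"
      then have "1.82 ^ 3 < x ^ 3" by (intro power_strict_mono) auto
      then show False using x m3 by (simp add: power3_eq_cube)
    qed
    then have b: "\<eta> \<le> 0.82" using 1 by (simp add: \<eta>_def)
    have S': "S \<ge> 1 / 2" using S poly[OF b] b \<eta> 1 by (simp add: power2_eq_square)
    have "(5::real) \<le> 27 powr (1 / real 2)" by (rule le_powr_inverse) auto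
    also have "\<dots> \<le> 27 powr S" using S' by (intro powr_mono) auto
    finally show ?thesis using S' m3 1 by simp
  next
    case 2
    then have m13: "m \<le> 13" using m_less by simp
    have "x \<le> 2.97"
    proof (rule ccontr)
      assume "\<not> ?thesis"
      then have "2.97 ^ 3 < x ^ 3" by (intro power_strict_mono) auto
      then show False using x m13 by (simp add: power3_eq_cube)
    qed
    then have b: "\<eta> \<le> 0.97" using 2 by (simp add: \<eta>_def)
    have S': "S \<ge> 13 / 12" using S poly[OF b] b \<eta> 2 by (simp add: power2_eq_square)
    have "(1.2::real) \<le> 27 powr (1 / real 12)" by (rule le_powr_inverse) (auto simp: power_divide)
    then have "27 * (1.2::real) \<le> 27 * 27 powr (1 / 12)" by simp
    also have "\<dots> = 27 powr (13 / 12)" using powr_add[of "27::real" 1 "1 / 12"] by simp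
    also have "\<dots> \<le> 27 powr S" using S' by (intro powr_mono) auto
    finally show ?thesis using S' m13 2 by simp
  next
    case 3
    have "\<eta> ^ 2 \<le> \<eta>" "\<eta> ^ 3 / real D \<le> 1 / 3"
    proof -
      show "\<eta> ^ 2 \<le> \<eta>" using \<eta> by (simp add: power2_eq_square mult_left_le)
      have "\<eta> ^ 3 / real D \<le> 1 / real D" using \<eta> by (intro divide_right_mono) (auto simp: power_le_one)
      also have "\<dots> \<le> 1 / 3" using 3 by simp
      finally show "\<eta> ^ 3 / real D \<le> 1 / 3" .
    qed
    \<comment> \<open>\<open>\<eta> - 3 / 2 * \<eta> ^ 2\<close> is at least \<open>- 1 / 2\<close>,
      and \<open>1 - 1 / 2 - 1 / 3 = 1 / 6\<close>.\<close>
    then have S': "S \<ge> real D / 2 + 1 / 6" using S \<eta> by simp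
    have "1 / 2 + 9 / 16 * (2 ^ D * real m) = 1 / 2 + 9 / 32 * (2 ^ D * (2 * real m))" by simp
    also have "\<dots> \<le> 1 / 2 + 9 / 32 * (2 ^ D * (real D + 1) ^ 3)"
      using m_less by (intro add_left_mono mult_left_mono) auto
    also have "\<dots> \<le> 17 / 10 * 5 ^ D" using exponential_bound[OF 3] .
    also have "\<dots> \<le> 27 powr (1 / real 6) * (27 powr (1 / real 2)) ^ D"
    proof (intro mult_mono power_mono)
      show "(17 / 10::real) \<le> 27 powr (1 / real 6)" by (rule le_powr_inverse) (auto simp: power_divide)
      show "(5::real) \<le> 27 powr (1 / real 2)" by (rule le_powr_inverse) auto
    qed auto
    also have "\<dots> = 27 powr (real D / 2 + 1 / 6)"
      by (simp add: powr_power powr_add)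
    also have "\<dots> \<le> 27 powr S" using S' by (intro powr_mono) auto
    finally show ?thesis using S' by simp
  qed
  then show "S \<ge> 0" "1 / 2 + 9 / 16 * (2 ^ D * real m) \<le> 27 powr S" by auto
qed

text \<open>After splitting off \<open>8 * m\<close>, the remaining
  \<open>1 / 2 + 9 / 16 * (2 ^ D * m)\<close> is paid for by the surplus \<open>S\<close> in each of
  the \<open>k\<close> colours, via
  \<open>27 powr S = 3 powr (3 * S) \<le> k powr (k * S)\<close>.\<close>

lemma total_size_le:
  fixes m k D h e :: nat and x :: real
  assumes m: "m \<ge> 1" and k: "k \<ge> 3" and D: "D \<ge> 1" and x: "x ^ 3 = 2 * real m" "real D \<le> x" "x < real D + 1"
    and h: "h * D \<le> 2 * m" and e: "2 * real e = 2 * real h + (real D - 1) * (real D + 2)"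
  shows "real k ^ (k * e) * (4 * real m + 9 / 8 * (2 ^ D * (2 * real m) ^ 2))
    \<le> real k powr (real k * (3 / 2 * x ^ 2 + x)) * (8 * real m)"
proof -
  define S where "S = 3 / 2 * x ^ 2 + x - real e"
  have S: "S \<ge> 0" "1 / 2 + 9 / 16 * (2 ^ D * real m) \<le> 27 powr S"
    using loss_le_slack[OF m D x h e] by (auto simp: S_def)
  note S(2)
  also have "(27::real) powr S = 3 powr (3 * S)"
    using powr_powr[of 3 3 S] by simp
  also have "\<dots> \<le> real k powr (3 * S)" using k S by (intro powr_mono2) auto
  also have "\<dots> \<le> real k powr (real k * S)" using k S by (intro powr_mono mult_right_mono) auto
  finally have le: "1 / 2 + 9 / 16 * (2 ^ D * real m) \<le> real k powr (real k * S)" .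
  have "real k ^ (k * e) * (4 * real m + 9 / 8 * (2 ^ D * (2 * real m) ^ 2))
      = real k ^ (k * e) * (1 / 2 + 9 / 16 * (2 ^ D * real m)) * (8 * real m)"
    by (simp add: algebra_simps power2_eq_square)
  also have "\<dots> \<le> real k ^ (k * e) * real k powr (real k * S) * (8 * real m)"
    using le by (intro mult_right_mono mult_left_mono) auto
  also have "real k ^ (k * e) * real k powr (real k * S) = real k powr (real k * (3 / 2 * x ^ 2 + x))"
    using k by (simp add: S_def powr_add[symmetric] powr_realpow[symmetric] algebra_simps)
  finally show ?thesis .
qed

theorem theorem1:
  fixes V :: "'a set" and E :: "'a set set" and m k :: nat
  assumes "simple_graph V E"
    and "card E = m"
    and "\<nexists>v. isolated_vertex V E v"
    and "k \<ge> 3"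
  shows "real (multicolor_ramsey k V E)
    \<le> real k powr (3 * 2 powr (- 1 / 3) * real k * real m powr (2 / 3)
                    + real k * (2 * real m) powr (1 / 3)) * (8 * real m)"
proof (cases "m = 0")
  case True
  \<comment> \<open>A graph with neither edges nor isolated vertices is empty; its Ramsey number and
    the bound are both 0.\<close>
  have "finite V" and E: "E \<subseteq> nsets V 2" using assms(1) by (auto simp: simple_graph_def)
  then have "finite E" by (meson finite_imp_finite_nsets finite_subset)
  then have "E = {}" using assms(2) True by simp
  moreover have "V = {}" using assms(3) \<open>E = {}\<close> by (auto simp: isolated_vertex_def)
  ultimately have "ramsey_arrow 0 k V E"
    using assms(1,4) by (intro ramsey_arrowI) (auto intro!: exI[of _ 0])
  then have "multicolor_ramsey k V E \<le> 0" unfolding multicolor_ramsey_def by (rule Least_le)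
  then show ?thesis by simp
next
  case False
  then have m: "m \<ge> 1" by simp
  \<comment> \<open>To leading order a colour costs \<open>2 * m / D + D ^ 2 / 2\<close>, which is
    minimal at \<open>D ^ 3 = 2 * m\<close> with value \<open>3 / 2 * x ^ 2\<close>.\<close>
  define x where "x = (2 * real m) powr (1 / 3)"
  define D where "D = nat \<lfloor>x\<rfloor>"
  have x3: "x ^ 3 = 2 * real m" using m by (simp add: x_def powr_power)
  have "1 \<le> x" using m by (simp add: x_def ge_one_powr_ge_zero)
  then have D: "D \<ge> 1" "real D \<le> x" "x < real D + 1"
    by (auto simp: D_def le_nat_iff le_floor_iff)
  have SucD: "Suc (D - 1) = D" using D by simp
  have "real (multicolor_ramsey k V E) \<le> real k powr (real k * (3 / 2 * x ^ 2 + x)) * (8 * real m)"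
  proof (rule multicolor_ramsey_le[OF assms(1,2) m assms(3,4), where d = "D - 1"], unfold SucD)
    fix h e :: nat
    assume h: "h * D \<le> 2 * m" and "2 * e = 2 * h + (D - 1) * (D - 1 + 3)"
    then have "real (2 * e) = real (2 * h + (D - 1) * (D - 1 + 3))" by (simp only:)
    then have "2 * real e = 2 * real h + (real D - 1) * (real D + 2)"
      using D(1) by (cases D) (simp_all add: algebra_simps)
    then show "real k ^ (k * e) * (4 * real m + 9 / 8 * (2 ^ D * (2 * real m) ^ 2))
        \<le> real k powr (real k * (3 / 2 * x ^ 2 + x)) * (8 * real m)"
      by (rule total_size_le[OF m assms(4) D(1) x3 D(2,3) h])
  qed
  also have "real k * (3 / 2 * x ^ 2 + x) = 3 * 2 powr (- 1 / 3) * real k * real m powr (2 / 3)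
      + real k * (2 * real m) powr (1 / 3)"
  proof -
    have "x ^ 2 = (2 * real m) powr (2 / 3)"
      using m by (simp add: x_def powr_power)
    also have "\<dots> = 2 powr (2 / 3) * real m powr (2 / 3)"
      by (rule powr_mult)
    finally have "x ^ 2 = 2 powr (2 / 3) * real m powr (2 / 3)" .
    moreover have "(2::real) powr (2 / 3) = 2 * 2 powr (- 1 / 3)"
      using powr_add[of "2::real" 1 "- 1 / 3"] by simp
    ultimately show ?thesis by (simp add: x_def algebra_simps)
  qed
  finally show ?thesis .
qed

end
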